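(* Let $\mathcal{U}=\begin{pmatrix}M_u&\alpha_u\\\beta_u^*&K_u\end{pmatrix}$ and $\mathcal{V}=\begin{pmatrix}M_v&\alpha_v\\\beta_v^*&K_v\end{pmatrix}$ be $(p+\delta)\times(p+\delta)$ unitary matrices, where $K_u,K_v$ are $\delta\times\delta$, $\alpha_u,\alpha_v,\beta_u,\beta_v$ are $p\times\delta$ and $M_u,M_v$ are $p\times p$. Assume that $K_vz-K_u$ is invertible (as a rational matrix function of $z$). Given a $p\times p$ proper rational transfer function $G(z)$ and a minimal realization $G(z)=D+C(zI_k-A)^{-1}B$, the formula $$\begin{pmatrix}\widetilde D&\widetilde C\\\widetilde B&\widetilde A\end{pmatrix}=\begin{pmatrix}\mathcal{U}&0\\0&I_k\end{pmatrix}\begin{pmatrix}D&0&C\\0&I_\delta&0\\ B&0&A\end{pmatrix}\begin{pmatrix}\mathcal{V}^*&0\\0&I_k\end{pmatrix},$$ in which $D,\widetilde D$ are $p\times p$, $A$ is $k\times k$ and $\widetilde A$ is $(\delta+k)\times(\delta+k)$, defines a mapping $$G(z)\mapsto\widetilde G(z)=\widetilde D+\widetilde C(zI_{\delta+k}-\widetilde A)^{-1}\widetilde B$$ (that is, $\widetilde G$ depends only on $G$, not on the chosen minimal realization). This mapping coincides with the linear fractional transformation $\widetilde G=T_{\Phi_{\mathcal{U},\mathcal{V}}}(G)$ associated with the $2p\times2p$ function $$\Phi_{\mathcal{U},\mathcal{V}}(z)=M+\alpha(K_vz-K_u)^{-1}\beta^*J\begin{pmatrix}I_p&0\\0&zI_p\end{pmatrix},$$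 where $M=\begin{pmatrix}M_u&0\\0&M_v\end{pmatrix}$, $\alpha=\begin{pmatrix}\alpha_u\\\alpha_v\end{pmatrix}$, $\beta=\begin{pmatrix}\beta_u\\\beta_v\end{pmatrix}$, and $\Phi_{\mathcal{U},\mathcal{V}}$ is $J$-lossless.
   Context: $^*$ denotes conjugate transpose. $J=\begin{pmatrix}I_p&0\\0&-I_p\end{pmatrix}$. A $2p\times2p$ rational matrix function $\Theta$ is $J$-lossless if at every point of analyticity $z$ of $\Theta$ one has $\Theta(z)J\Theta(z)^*\le J$ when $|z|>1$ and $\Theta(z)J\Theta(z)^*=J$ when $|z|=1$. For $\Theta=\begin{pmatrix}\Theta_{11}&\Theta_{12}\\\Theta_{21}&\Theta_{22}\end{pmatrix}$ with $p\times p$ blocks, the linear fractional transformation acts on $p\times p$ rational functions $F$ by $T_\Theta(F)=(\Theta_{11}F+\Theta_{12})(\Theta_{21}F+\Theta_{22})^{-1}$. *)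

theory Defs
  imports
    "Jordan_Normal_Form.Schur_Decomposition"
    "Jordan_Normal_Form.Gauss_Jordan_Elimination"
    "HOL-Computational_Algebra.Computational_Algebra"
    "HOL-Computational_Algebra.Field_as_Ring"
begin

text \<open>
  Rational functions of one complex variable are elements of the field of fractions of
  \<open>complex poly\<close>; rational matrix functions are matrices over this field. The matrix type
  carries its dimensions as natural numbers, which may be \<open>0\<close>: this matters for state spaces,
  since a constant transfer function has a minimal realization of state dimension \<open>0\<close>.
\<close>

type_synonym ratfun = "complex poly fract"

definition ratvar :: ratfun where
  "ratvar = to_fract [:0, 1:]"

definition const_mat :: "complex mat \<Rightarrow> ratfun mat" where
  "const_mat A = map_mat (\<lambda>c. to_fract [:c:]) A"

text \<open>\<open>quot_of_fract\<close> is the representation by coprime numerator and (monic) denominator.\<close>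

definition ratfun_analytic_at :: "ratfun \<Rightarrow> complex \<Rightarrow> bool" where
  "ratfun_analytic_at f z \<longleftrightarrow> poly (snd (quot_of_fract f)) z \<noteq> 0"

definition ratfun_eval :: "ratfun \<Rightarrow> complex \<Rightarrow> complex" where
  "ratfun_eval f z = poly (fst (quot_of_fract f)) z / poly (snd (quot_of_fract f)) z"

definition ratfun_proper :: "ratfun \<Rightarrow> bool" where
  "ratfun_proper f \<longleftrightarrow> degree (fst (quot_of_fract f)) \<le> degree (snd (quot_of_fract f))"

definition ratmat_analytic_at :: "ratfun mat \<Rightarrow> complex \<Rightarrow> bool" where
  "ratmat_analytic_at F z \<longleftrightarrow> (\<forall>f \<in> elements_mat F. ratfun_analytic_at f z)"

definition ratmat_eval :: "ratfun mat \<Rightarrow> complex \<Rightarrow> complex mat" where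
  "ratmat_eval F z = map_mat (\<lambda>f. ratfun_eval f z) F"

definition ratmat_proper :: "ratfun mat \<Rightarrow> bool" where
  "ratmat_proper F \<longleftrightarrow> (\<forall>f \<in> elements_mat F. ratfun_proper f)"

text \<open>Only meaningful for an invertible matrix; otherwise the value is unspecified.\<close>

definition inv_mat :: "'a :: field mat \<Rightarrow> 'a mat" where
  "inv_mat A = the (mat_inverse A)"

definition append_cols :: "'a :: zero mat \<Rightarrow> 'a mat \<Rightarrow> 'a mat" (infixr \<open>@\<^sub>c\<close> 65) where
  "A @\<^sub>c B = four_block_mat A B (0\<^sub>m 0 (dim_col A)) (0\<^sub>m 0 (dim_col B))"

definition unitary_mat :: "nat \<Rightarrow> complex mat \<Rightarrow> bool" where
  "unitary_mat n U \<longleftrightarrow> U \<in> carrier_mat n n \<and>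
     U * mat_adjoint U = 1\<^sub>m n \<and> mat_adjoint U * U = 1\<^sub>m n"

text \<open>The comparison below is the one on complex numbers, so it includes that the
  quadratic form of \<open>B - A\<close> is real.\<close>

definition loewner_le :: "nat \<Rightarrow> complex mat \<Rightarrow> complex mat \<Rightarrow> bool" where
  "loewner_le n A B \<longleftrightarrow> A \<in> carrier_mat n n \<and> B \<in> carrier_mat n n \<and>
     (\<forall>v \<in> carrier_vec n. 0 \<le> ((B - A) *\<^sub>v v) \<bullet>c v)"

definition J_mat :: "nat \<Rightarrow> complex mat" where
  "J_mat p = diag_block_mat [1\<^sub>m p, - 1\<^sub>m p]"

definition J_lossless :: "nat \<Rightarrow> ratfun mat \<Rightarrow> bool" where
  "J_lossless p \<Theta> \<longleftrightarrow> \<Theta> \<in> carrier_mat (2 * p) (2 * p) \<and>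
     (\<forall>z. ratmat_analytic_at \<Theta> z \<longrightarrow>
        (let T = ratmat_eval \<Theta> z; J = J_mat p in
          (cmod z > 1 \<longrightarrow> loewner_le (2 * p) (T * J * mat_adjoint T) J) \<and>
          (cmod z = 1 \<longrightarrow> T * J * mat_adjoint T = J)))"

text \<open>\<open>lft_den\<close> is the matrix \<open>\<Theta>\<^sub>2\<^sub>1 F + \<Theta>\<^sub>2\<^sub>2\<close> which must be invertible over the field of
  rational functions for the linear fractional transformation to be defined at \<open>F\<close>.\<close>

definition lft_num :: "nat \<Rightarrow> ratfun mat \<Rightarrow> ratfun mat \<Rightarrow> ratfun mat" where
  "lft_num p \<Theta> F = (case split_block \<Theta> p p of (\<Theta>11, \<Theta>12, \<Theta>21, \<Theta>22) \<Rightarrow> \<Theta>11 * F + \<Theta>12)"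

definition lft_den :: "nat \<Rightarrow> ratfun mat \<Rightarrow> ratfun mat \<Rightarrow> ratfun mat" where
  "lft_den p \<Theta> F = (case split_block \<Theta> p p of (\<Theta>11, \<Theta>12, \<Theta>21, \<Theta>22) \<Rightarrow> \<Theta>21 * F + \<Theta>22)"

definition lft :: "nat \<Rightarrow> ratfun mat \<Rightarrow> ratfun mat \<Rightarrow> ratfun mat" where
  "lft p \<Theta> F = lft_num p \<Theta> F * inv_mat (lft_den p \<Theta> F)"

definition transfer_function ::
  "nat \<Rightarrow> complex mat \<Rightarrow> complex mat \<Rightarrow> complex mat \<Rightarrow> complex mat \<Rightarrow> ratfun mat" where
  "transfer_function k A B C D =
     const_mat D + const_mat C * inv_mat (ratvar \<cdot>\<^sub>m 1\<^sub>m k - const_mat A) * const_mat B"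

definition is_realization ::
  "nat \<Rightarrow> nat \<Rightarrow> complex mat \<Rightarrow> complex mat \<Rightarrow> complex mat \<Rightarrow> complex mat \<Rightarrow> ratfun mat \<Rightarrow> bool"
where
  "is_realization p k A B C D G \<longleftrightarrow>
     A \<in> carrier_mat k k \<and> B \<in> carrier_mat k p \<and> C \<in> carrier_mat p k \<and> D \<in> carrier_mat p p \<and>
     G = transfer_function k A B C D"

definition is_minimal_realization ::
  "nat \<Rightarrow> nat \<Rightarrow> complex mat \<Rightarrow> complex mat \<Rightarrow> complex mat \<Rightarrow> complex mat \<Rightarrow> ratfun mat \<Rightarrow> bool"
where
  "is_minimal_realization p k A B C D G \<longleftrightarrow> is_realization p k A B C D G \<and>
     (\<forall>k' A' B' C' D'. is_realization p k' A' B' C' D' G \<longrightarrow> k \<le> k')"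

text \<open>\<open>A'\<close>, \<open>B'\<close>, \<open>C'\<close>, \<open>D'\<close> are the matrices written with a tilde in the usual notation. The
  middle factor is the \<open>3 \<times> 3\<close> block matrix with rows \<open>(D, 0, C)\<close>, \<open>(0, I, 0)\<close>, \<open>(B, 0, A)\<close>.\<close>

definition realization_update ::
  "nat \<Rightarrow> nat \<Rightarrow> complex mat \<Rightarrow> complex mat \<Rightarrow> nat \<Rightarrow>
   complex mat \<Rightarrow> complex mat \<Rightarrow> complex mat \<Rightarrow> complex mat \<Rightarrow>
   complex mat \<Rightarrow> complex mat \<Rightarrow> complex mat \<Rightarrow> complex mat \<Rightarrow> bool"
where
  "realization_update p \<delta> U V k A B C D A' B' C' D' \<longleftrightarrow>
     A' \<in> carrier_mat (\<delta> + k) (\<delta> + k) \<and> B' \<in> carrier_mat (\<delta> + k) p \<and>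
     C' \<in> carrier_mat p (\<delta> + k) \<and> D' \<in> carrier_mat p p \<and>
     four_block_mat D' C' B' A' =
       diag_block_mat [U, 1\<^sub>m k]
       * four_block_mat (diag_block_mat [D, 1\<^sub>m \<delta>]) (C @\<^sub>r 0\<^sub>m \<delta> k)
                        (B @\<^sub>c 0\<^sub>m k \<delta>)                A
       * diag_block_mat [mat_adjoint V, 1\<^sub>m k]"

text \<open>\<open>H\<close> is obtained from \<open>G\<close> through some minimal realization of \<open>G\<close>.\<close>

definition corresponds ::
  "nat \<Rightarrow> nat \<Rightarrow> complex mat \<Rightarrow> complex mat \<Rightarrow> ratfun mat \<Rightarrow> ratfun mat \<Rightarrow> bool"
where
  "corresponds p \<delta> U V G H \<longleftrightarrow>
     (\<exists>k A B C D A' B' C' D'.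
        is_minimal_realization p k A B C D G \<and>
        realization_update p \<delta> U V k A B C D A' B' C' D' \<and>
        H = transfer_function (\<delta> + k) A' B' C' D')"

definition Phi ::
  "nat \<Rightarrow> complex mat \<Rightarrow> complex mat \<Rightarrow> complex mat \<Rightarrow> complex mat \<Rightarrow>
   complex mat \<Rightarrow> complex mat \<Rightarrow> complex mat \<Rightarrow> complex mat \<Rightarrow> ratfun mat"
where
  "Phi p Mu \<alpha>u \<beta>u Ku Mv \<alpha>v \<beta>v Kv =
     (let M = diag_block_mat [Mu, Mv]; \<alpha> = \<alpha>u @\<^sub>r \<alpha>v; \<beta> = \<beta>u @\<^sub>r \<beta>v in
       const_mat M
       + const_mat \<alpha> * inv_mat (ratvar \<cdot>\<^sub>m const_mat Kv - const_mat Ku)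
         * const_mat (mat_adjoint \<beta>) * const_mat (J_mat p)
         * diag_block_mat [1\<^sub>m p, ratvar \<cdot>\<^sub>m 1\<^sub>m p])"

end

theory Submission
  imports Defs
begin

text \<open>
  Think of a realization as a linear system: an input \<open>u\<close> and a state \<open>x\<close> are mapped by the block matrix
  \<open>(D, C; B, A)\<close> to the output and to \<open>z x\<close>, and the transfer function is what remains after \<open>x\<close> has been
  eliminated. The updated realization is the given system enclosed between \<open>V\<^sup>*\<close> and \<open>U\<close>, with \<open>\<delta>\<close>
  additional state variables \<open>s\<close> that pass from the output of \<open>U\<close> to the input of \<open>V\<^sup>*\<close>. If the inner system
  receives the input \<open>1\<close>, and \<open>T\<close> denotes the signal on the \<open>\<delta>\<close> wires that bypass it, then the input and
  state \<open>(Den, S)\<close> outside are \<open>V (1, T)\<close>, and the output and \<open>z\<close> times the state are \<open>U (G, T)\<close>.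
  Equating the two expressions for \<open>z S\<close> gives \<open>(K_v z - K_u) T = \<beta>_u\<^sup>* G - z \<beta>_v\<^sup>*\<close>, and after solving for \<open>T\<close>
  the input \<open>Den\<close> and the output \<open>Num\<close> are the denominator and the numerator of \<open>T\<^sub>\<Phi>(G)\<close>. This is
  \<open>transfer_function_realization_update\<close> and \<open>lft_of_corresponds\<close>. The denominator is invertible because
  nothing is lost on the way: the input \<open>Den\<close> determines the state \<open>S\<close>, and \<open>V\<^sup>*\<close> recovers the inner input
  \<open>1\<close> from \<open>(Den, S)\<close>.

  As the linear fractional transformation involves only \<open>G\<close>, the result is independent of the realization. For the
  mapping to be defined everywhere, each proper \<open>G\<close> must have a realization, which is obtained in
  \<open>proper_imp_realizable\<close> by splitting off one pole at a time; one of least dimension is then minimal.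

  Losslessness expresses conservation of energy in \<open>U\<close> and \<open>V\<close>. Where the pencil is regular, comparing norms
  before and after the two unitary matrices yields
  \<open>J - \<Phi> J \<Phi>\<^sup>* = (|z|\<^sup>2 - 1) Q Q\<^sup>*\<close> with \<open>Q = \<alpha> (K_v z - K_u)\<^sup>-\<^sup>1\<close> (\<open>lossless_identity\<close>).
  At the remaining points of analyticity the inequality and the equality follow by continuity, along points of the
  same modulus (\<open>J_losslessI_off_finite\<close>).
\<close>

section \<open>Block matrices\<close>

lemma carrier_append_cols [simp, intro]:
  "A \<in> carrier_mat n m1 \<Longrightarrow> B \<in> carrier_mat n m2 \<Longrightarrow> A @\<^sub>c B \<in> carrier_mat n (m1 + m2)"
  by (auto simp: append_cols_def)

lemma diag_block_mat_pair:
  assumes "A \<in> carrier_mat n1 m1" "B \<in> carrier_mat n2 m2"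
  shows "diag_block_mat [A, B] = four_block_mat A (0\<^sub>m n1 m2) (0\<^sub>m n2 m1) B"
  by (rule eq_matI) (use assms in \<open>auto simp: Let_def\<close>)

lemma append_rows_inject:
  assumes "A \<in> carrier_mat n1 m" "A' \<in> carrier_mat n1 m"
    and "B \<in> carrier_mat n2 m" "B' \<in> carrier_mat n2 m"
    and eq: "A @\<^sub>r B = A' @\<^sub>r B'"
  shows "A = A'" "B = B'"
proof -
  have ix: "(A @\<^sub>r B) $$ (i, j) = (A' @\<^sub>r B') $$ (i, j)" for i j
    using eq by simp
  show "A = A'"
  proof (rule eq_matI)
    fix i j assume "i < dim_row A'" "j < dim_col A'"
    then show "A $$ (i, j) = A' $$ (i, j)"
      using ix[of i j] assms by (simp add: append_rows_def)
  qed (use assms in auto)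
  show "B = B'"
  proof (rule eq_matI)
    fix i j assume "i < dim_row B'" "j < dim_col B'"
    then show "B $$ (i, j) = B' $$ (i, j)"
      using ix[of "n1 + i" j] assms by (simp add: append_rows_def)
  qed (use assms in auto)
qed

lemma four_block_mat_inject:
  assumes carrier: "A \<in> carrier_mat n1 m1" "A' \<in> carrier_mat n1 m1"
      "B \<in> carrier_mat n1 m2" "B' \<in> carrier_mat n1 m2"
      "C \<in> carrier_mat n2 m1" "C' \<in> carrier_mat n2 m1"
      "D \<in> carrier_mat n2 m2" "D' \<in> carrier_mat n2 m2"
    and eq: "four_block_mat A B C D = four_block_mat A' B' C' D'"
  shows "A = A'" "B = B'" "C = C'" "D = D'"
proof -
  have ix: "four_block_mat A B C D $$ (i, j) = four_block_mat A' B' C' D' $$ (i, j)" for i j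
    using eq by simp
  show "A = A'"
  proof (rule eq_matI)
    fix i j assume "i < dim_row A'" "j < dim_col A'"
    then show "A $$ (i, j) = A' $$ (i, j)" using ix[of i j] carrier by simp
  qed (use carrier in auto)
  show "B = B'"
  proof (rule eq_matI)
    fix i j assume "i < dim_row B'" "j < dim_col B'"
    then show "B $$ (i, j) = B' $$ (i, j)" using ix[of i "m1 + j"] carrier by simp
  qed (use carrier in auto)
  show "C = C'"
  proof (rule eq_matI)
    fix i j assume "i < dim_row C'" "j < dim_col C'"
    then show "C $$ (i, j) = C' $$ (i, j)" using ix[of "n1 + i" j] carrier by simp
  qed (use carrier in auto)
  show "D = D'"
  proof (rule eq_matI)
    fix i j assume "i < dim_row D'" "j < dim_col D'"
    then show "D $$ (i, j) = D' $$ (i, j)" using ix[of "n1 + i" "m1 + j"] carrier by simp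
  qed (use carrier in auto)
qed

lemma split_block_four_block_mat:
  assumes "A \<in> carrier_mat n1 m1" "B \<in> carrier_mat n1 m2"
    and "C \<in> carrier_mat n2 m1" "D \<in> carrier_mat n2 m2"
  shows "split_block (four_block_mat A B C D) n1 m1 = (A, B, C, D)"
proof -
  obtain A' B' C' D' where
    s: "split_block (four_block_mat A B C D) n1 m1 = (A', B', C', D')"
    by (metis prod_cases4)
  have d: "dim_row (four_block_mat A B C D) = n1 + n2" "dim_col (four_block_mat A B C D) = m1 + m2"
    using assms by auto
  note sb = split_block[OF s d]
  show ?thesis
    using s four_block_mat_inject[OF assms(1) sb(1) assms(2) sb(2) assms(3) sb(3) assms(4) sb(4) sb(5)]
    by simp
qed

lemma append_rows_assoc:
  assumes "A \<in> carrier_mat n1 m" "B \<in> carrier_mat n2 m" "C \<in> carrier_mat n3 m"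
  shows "(A @\<^sub>r B) @\<^sub>r C = A @\<^sub>r (B @\<^sub>r C)"
  by (rule eq_matI) (use assms in \<open>auto simp: append_rows_def\<close>)

lemma append_rows_add:
  assumes "A \<in> carrier_mat n1 m" "B \<in> carrier_mat n2 m" "A' \<in> carrier_mat n1 m" "B' \<in> carrier_mat n2 m"
  shows "(A @\<^sub>r B) + (A' @\<^sub>r B') = (A + A') @\<^sub>r (B + B')"
  by (rule eq_matI) (use assms in \<open>auto simp: append_rows_def\<close>)

lemma append_rows_smult:
  assumes "A \<in> carrier_mat n1 m" "B \<in> carrier_mat n2 m"
  shows "c \<cdot>\<^sub>m (A @\<^sub>r B) = (c \<cdot>\<^sub>m A) @\<^sub>r (c \<cdot>\<^sub>m B)"
  by (rule eq_matI) (use assms in \<open>auto simp: append_rows_def\<close>)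

lemma append_rows_mult:
  fixes A :: "'a :: comm_ring_1 mat"
  assumes "A \<in> carrier_mat n1 m" "B \<in> carrier_mat n2 m" "X \<in> carrier_mat m l"
  shows "(A @\<^sub>r B) * X = (A * X) @\<^sub>r (B * X)"
  by (rule eq_matI) (use assms in \<open>auto simp: append_rows_def scalar_prod_def\<close>)

lemma four_block_mat_mult_append_rows:
  fixes A :: "'a :: comm_ring_1 mat"
  assumes "A \<in> carrier_mat n1 m1" "B \<in> carrier_mat n1 m2" "C \<in> carrier_mat n2 m1" "D \<in> carrier_mat n2 m2"
    and "X \<in> carrier_mat m1 l" "Y \<in> carrier_mat m2 l"
  shows "four_block_mat A B C D * (X @\<^sub>r Y) = (A * X + B * Y) @\<^sub>r (C * X + D * Y)"
proof -
  have "four_block_mat A B C D * (X @\<^sub>r Y) =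
    four_block_mat (A * X + B * Y) (A * 0\<^sub>m m1 0 + B * 0\<^sub>m m2 0) (C * X + D * Y) (C * 0\<^sub>m m1 0 + D * 0\<^sub>m m2 0)"
    using assms unfolding append_rows_def
    by (subst mult_four_block_mat[of _ n1 m1 _ m2 _ n2 _ _ l _ 0]) auto
  also have "\<dots> = (A * X + B * Y) @\<^sub>r (C * X + D * Y)"
    by (rule eq_matI) (use assms in \<open>auto simp: append_rows_def\<close>)
  finally show ?thesis .
qed

lemma append_cols_mult_append_rows:
  fixes A :: "'a :: comm_ring_1 mat"
  assumes "A \<in> carrier_mat n m1" "B \<in> carrier_mat n m2"
    and "X \<in> carrier_mat m1 l" "Y \<in> carrier_mat m2 l"
  shows "(A @\<^sub>c B) * (X @\<^sub>r Y) = A * X + B * Y"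
proof -
  have "(A @\<^sub>c B) * (X @\<^sub>r Y) = (A * X + B * Y) @\<^sub>r (0\<^sub>m 0 m1 * X + 0\<^sub>m 0 m2 * Y)"
    unfolding append_cols_def using assms
    by (subst four_block_mat_mult_append_rows[of _ n m1 _ m2 _ 0]) auto
  also have "\<dots> = A * X + B * Y"
    by (rule eq_matI) (use assms in \<open>auto simp: append_rows_def\<close>)
  finally show ?thesis .
qed

lemma mult_append_cols:
  fixes A :: "'a :: comm_ring_1 mat"
  assumes "A \<in> carrier_mat n m" "X \<in> carrier_mat m l1" "Y \<in> carrier_mat m l2"
  shows "A * (X @\<^sub>c Y) = (A * X) @\<^sub>c (A * Y)"
  by (rule eq_matI) (use assms in \<open>auto simp: append_cols_def scalar_prod_def\<close>)

lemma append_cols_mult_four_block_mat: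
  fixes A :: "'a :: comm_ring_1 mat"
  assumes "X \<in> carrier_mat n m1" "Y \<in> carrier_mat n m2"
    and "A \<in> carrier_mat m1 l1" "B \<in> carrier_mat m1 l2" "C \<in> carrier_mat m2 l1" "D \<in> carrier_mat m2 l2"
  shows "(X @\<^sub>c Y) * four_block_mat A B C D = (X * A + Y * C) @\<^sub>c (X * B + Y * D)"
proof -
  have "(X @\<^sub>c Y) * four_block_mat A B C D =
     four_block_mat (X * A + Y * C) (X * B + Y * D) (0\<^sub>m 0 m1 * A + 0\<^sub>m 0 m2 * C) (0\<^sub>m 0 m1 * B + 0\<^sub>m 0 m2 * D)"
    using assms unfolding append_cols_def
    by (subst mult_four_block_mat[of _ n m1 _ m2 _ 0 _ _ l1 _ l2]) auto
  also have "\<dots> = (X * A + Y * C) @\<^sub>c (X * B + Y * D)"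
    by (rule eq_matI) (use assms in \<open>auto simp: append_cols_def\<close>)
  finally show ?thesis .
qed

lemma append_cols_append_rows:
  assumes "A \<in> carrier_mat n1 m1" "B \<in> carrier_mat n1 m2" "C \<in> carrier_mat n2 m1" "D \<in> carrier_mat n2 m2"
  shows "(A @\<^sub>r C) @\<^sub>c (B @\<^sub>r D) = four_block_mat A B C D"
  by (rule eq_matI) (use assms in \<open>auto simp: append_rows_def append_cols_def\<close>)

section \<open>Conjugate transposes\<close>

lemma mat_adjoint_carrier [simp]:
  "A \<in> carrier_mat n m \<Longrightarrow> mat_adjoint A \<in> carrier_mat m n"
  "dim_row (mat_adjoint A) = dim_col A" "dim_col (mat_adjoint A) = dim_row A"
  by (auto simp: mat_adjoint_def)

lemma mat_adjoint_index [simp]: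
  "i < dim_col A \<Longrightarrow> j < dim_row A \<Longrightarrow> mat_adjoint A $$ (i, j) = conjugate (A $$ (j, i))"
  by (simp add: mat_adjoint_def mat_of_rows_index)

lemma mat_adjoint_append_rows:
  assumes "A \<in> carrier_mat n1 m" "B \<in> carrier_mat n2 m"
  shows "mat_adjoint (A @\<^sub>r B) = mat_adjoint A @\<^sub>c mat_adjoint B"
  by (rule eq_matI) (use assms in \<open>auto simp: append_rows_def append_cols_def\<close>)

lemma mat_adjoint_append_cols:
  assumes "A \<in> carrier_mat n m1" "B \<in> carrier_mat n m2"
  shows "mat_adjoint (A @\<^sub>c B) = mat_adjoint A @\<^sub>r mat_adjoint B"
  by (rule eq_matI) (use assms in \<open>auto simp: append_rows_def append_cols_def\<close>)

lemma mat_adjoint_mult: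
  fixes A :: "complex mat"
  assumes "A \<in> carrier_mat n m" "B \<in> carrier_mat m l"
  shows "mat_adjoint (A * B) = mat_adjoint B * mat_adjoint A"
  by (rule eq_matI) (use assms in \<open>auto simp: scalar_prod_def mult.commute intro!: sum.cong\<close>)

lemma mat_adjoint_smult: "mat_adjoint (c \<cdot>\<^sub>m A) = cnj c \<cdot>\<^sub>m mat_adjoint A" for A :: "complex mat"
  by (rule eq_matI) auto

section \<open>Constant rational matrices and inverses\<close>

interpretation const_ratfun: inj_comm_ring_hom "\<lambda>c :: complex. to_fract [:c:]"
proof
  show "to_fract [:1 :: complex:] = 1" by (metis one_pCons to_fract_1)
qed (auto simp flip: to_fract_add to_fract_mult)

lemma const_mat_carrier [simp]:
  "A \<in> carrier_mat n m \<Longrightarrow> const_mat A \<in> carrier_mat n m"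
  "dim_row (const_mat A) = dim_row A" "dim_col (const_mat A) = dim_col A"
  by (auto simp: const_mat_def)

lemma const_mat_mult:
  "A \<in> carrier_mat n m \<Longrightarrow> B \<in> carrier_mat m l \<Longrightarrow> const_mat (A * B) = const_mat A * const_mat B"
  unfolding const_mat_def by (rule const_ratfun.mat_hom_mult)

lemma const_mat_one: "const_mat (1\<^sub>m n) = 1\<^sub>m n"
  unfolding const_mat_def by (rule const_ratfun.mat_hom_one)

lemma const_mat_zero: "const_mat (0\<^sub>m n m) = 0\<^sub>m n m"
  unfolding const_mat_def by (rule eq_matI) auto

lemma const_mat_add:
  assumes "A \<in> carrier_mat n m" "B \<in> carrier_mat n m"
  shows "const_mat (A + B) = const_mat A + const_mat B"
  by (rule eq_matI) (use assms in \<open>auto simp: const_mat_def const_ratfun.hom_add\<close>)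

lemma const_mat_smult: "const_mat (c \<cdot>\<^sub>m A) = to_fract [:c:] \<cdot>\<^sub>m const_mat A"
  by (rule eq_matI) (auto simp: const_mat_def simp flip: const_ratfun.hom_mult)

lemma const_mat_four_block_mat:
  assumes "A \<in> carrier_mat n1 m1" "B \<in> carrier_mat n1 m2" "C \<in> carrier_mat n2 m1" "D \<in> carrier_mat n2 m2"
  shows "const_mat (four_block_mat A B C D) =
    four_block_mat (const_mat A) (const_mat B) (const_mat C) (const_mat D)"
  unfolding const_mat_def by (rule map_four_block_mat[OF assms])

lemma const_mat_append_rows:
  assumes "A \<in> carrier_mat n1 m" "B \<in> carrier_mat n2 m"
  shows "const_mat (A @\<^sub>r B) = const_mat A @\<^sub>r const_mat B"
  by (rule eq_matI) (use assms in \<open>auto simp: append_rows_def const_mat_def\<close>)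

lemma const_mat_append_cols:
  assumes "A \<in> carrier_mat n m1" "B \<in> carrier_mat n m2"
  shows "const_mat (A @\<^sub>c B) = const_mat A @\<^sub>c const_mat B"
  by (rule eq_matI) (use assms in \<open>auto simp: append_cols_def const_mat_def\<close>)

text \<open>
  The Gauss--Jordan procedure behind \<open>inv_mat\<close> fails only on matrices that are not units, and for
  square matrices over a field a left inverse already makes a unit. Hence invertibility is
  always obtained from a left inverse below.
\<close>

lemma inv_mat_of_left_inverse:
  fixes A :: "'a :: field mat"
  assumes A: "A \<in> carrier_mat n n" and L: "L \<in> carrier_mat n n" "L * A = 1\<^sub>m n"
  shows "inv_mat A \<in> carrier_mat n n" "A * inv_mat A = 1\<^sub>m n" "inv_mat A * A = 1\<^sub>m n"
    and "invertible_mat A"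
proof -
  have r: "A * L = 1\<^sub>m n" by (rule mat_mult_left_right_inverse[OF L(1) A L(2)])
  have "A \<in> Units (ring_mat TYPE('a) n ())"
    using A L r by (auto simp: Units_def ring_mat_def)
  then obtain B where "mat_inverse A = Some B"
    using mat_inverse(1)[OF A, of "()"] by (cases "mat_inverse A") auto
  then show "inv_mat A \<in> carrier_mat n n" "A * inv_mat A = 1\<^sub>m n" "inv_mat A * A = 1\<^sub>m n"
    using mat_inverse(2)[OF A] by (auto simp: inv_mat_def)
  show "invertible_mat A"
    using A L r unfolding invertible_mat_def inverts_mat_def square_mat.simps by auto
qed

lemma inv_mat_of_invertible:
  fixes A :: "'a :: field mat"
  assumes A: "A \<in> carrier_mat n n" and inv: "invertible_mat A"
  shows "inv_mat A \<in> carrier_mat n n" "A * inv_mat A = 1\<^sub>m n" "inv_mat A * A = 1\<^sub>m n"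
proof -
  obtain B where B: "A * B = 1\<^sub>m n" "B * A = 1\<^sub>m (dim_row B)"
    using inv A unfolding invertible_mat_def inverts_mat_def by auto
  have "dim_col B = n" using arg_cong[OF B(1), of dim_col] by simp
  moreover have "dim_row B = n" using arg_cong[OF B(2), of dim_col] A by simp
  ultimately have L: "B \<in> carrier_mat n n" "B * A = 1\<^sub>m n" using B by auto
  note * = inv_mat_of_left_inverse[OF A L]
  show "inv_mat A \<in> carrier_mat n n" "A * inv_mat A = 1\<^sub>m n" "inv_mat A * A = 1\<^sub>m n"
    by (fact *(1-3))+
qed

text \<open>
  The determinant of \<open>z I - A\<close> over the field of rational functions is the characteristic polynomial
  of \<open>A\<close>, which is monic and therefore nonzero.
\<close>

lemma resolvent:
  fixes A :: "complex mat"
  assumes A: "A \<in> carrier_mat k k"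
  shows "inv_mat (ratvar \<cdot>\<^sub>m 1\<^sub>m k - const_mat A) \<in> carrier_mat k k"
    and "(ratvar \<cdot>\<^sub>m 1\<^sub>m k - const_mat A) * inv_mat (ratvar \<cdot>\<^sub>m 1\<^sub>m k - const_mat A) = 1\<^sub>m k"
    and "inv_mat (ratvar \<cdot>\<^sub>m 1\<^sub>m k - const_mat A) * (ratvar \<cdot>\<^sub>m 1\<^sub>m k - const_mat A) = 1\<^sub>m k"
proof -
  let ?P = "ratvar \<cdot>\<^sub>m 1\<^sub>m k - const_mat A"
  interpret to_fract: comm_ring_hom "to_fract :: complex poly \<Rightarrow> ratfun"
    by standard auto
  have P: "?P \<in> carrier_mat k k" using A by auto
  have "?P = map_mat to_fract (char_poly_matrix A)"
    by (rule eq_matI) (use A in \<open>auto simp: ratvar_def const_mat_def char_poly_matrix_def simp flip: to_fract_uminus to_fract_diff\<close>)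
  then have "det ?P = to_fract (char_poly A)"
    by (simp add: char_poly_def)
  moreover have "char_poly A \<noteq> 0" using degree_monic_char_poly[OF A] by auto
  ultimately have "det ?P \<noteq> 0" by simp
  then have "?P \<in> Units (ring_mat TYPE(ratfun) k ())"
    by (rule det_non_zero_imp_unit[OF P])
  then obtain L where L: "L \<in> carrier_mat k k" "L * ?P = 1\<^sub>m k"
    by (auto simp: Units_def ring_mat_def)
  show "inv_mat ?P \<in> carrier_mat k k" "?P * inv_mat ?P = 1\<^sub>m k" "inv_mat ?P * ?P = 1\<^sub>m k"
    by (rule inv_mat_of_left_inverse[OF P L])+
qed

section \<open>The block form of the coefficient function\<close>

lemma Phi_expression_blocks:
  fixes Mu :: "'a :: comm_ring_1 mat"
  assumes [simp]: "Mu \<in> carrier_mat p p" "Mv \<in> carrier_mat p p"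
    "au \<in> carrier_mat p \<delta>" "av \<in> carrier_mat p \<delta>"
    "bu \<in> carrier_mat \<delta> p" "bv \<in> carrier_mat \<delta> p" "R \<in> carrier_mat \<delta> \<delta>"
  shows "diag_block_mat [Mu, Mv] + (au @\<^sub>r av) * R * (bu @\<^sub>c bv) *
      diag_block_mat [1\<^sub>m p, - 1\<^sub>m p] * diag_block_mat [1\<^sub>m p, z \<cdot>\<^sub>m 1\<^sub>m p] =
    four_block_mat (Mu + au * R * bu) (- (z \<cdot>\<^sub>m (au * R * bv)))
      (av * R * bu) (Mv - z \<cdot>\<^sub>m (av * R * bv))"
proof -
  note [simp] = assms[THEN carrier_matD(1)] assms[THEN carrier_matD(2)]
  let ?J = "diag_block_mat [1\<^sub>m p, - 1\<^sub>m p] :: 'a mat"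
  let ?Z = "diag_block_mat [1\<^sub>m p, z \<cdot>\<^sub>m 1\<^sub>m p] :: 'a mat"
  have J: "?J = four_block_mat (1\<^sub>m p) (0\<^sub>m p p) (0\<^sub>m p p) (- 1\<^sub>m p)"
    by (rule diag_block_mat_pair) auto
  have Z: "?Z = four_block_mat (1\<^sub>m p) (0\<^sub>m p p) (0\<^sub>m p p) (z \<cdot>\<^sub>m 1\<^sub>m p)"
    by (rule diag_block_mat_pair) auto
  have aR: "(au @\<^sub>r av) * R = (au * R) @\<^sub>r (av * R)"
    by (rule append_rows_mult[of _ p \<delta> _ p _ \<delta>]) auto
  have Jc: "?J \<in> carrier_mat (p + p) (p + p)" and Zc: "?Z \<in> carrier_mat (p + p) (p + p)"
    unfolding J Z by (rule four_block_carrier_mat; simp)+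
  have bJ: "(bu @\<^sub>c bv) * ?J = bu @\<^sub>c (- bv)"
  proof -
    have "(bu @\<^sub>c bv) * ?J = (bu * 1\<^sub>m p + bv * 0\<^sub>m p p) @\<^sub>c (bu * 0\<^sub>m p p + bv * (- 1\<^sub>m p))"
      unfolding J by (rule append_cols_mult_four_block_mat) auto
    also have "bu * 1\<^sub>m p + bv * 0\<^sub>m p p = bu" by simp
    also have "bu * 0\<^sub>m p p + bv * (- 1\<^sub>m p) = - bv" 
      by (simp add: uminus_mult_right_mat[of bv "1\<^sub>m p", symmetric] right_mult_one_mat[of _ \<delta> p])
    finally show ?thesis .
  qed
  have bJZ: "(bu @\<^sub>c - bv) * ?Z = bu @\<^sub>c (- (z \<cdot>\<^sub>m bv))"
  proof -
    have "(bu @\<^sub>c - bv) * ?Z = (bu * 1\<^sub>m p + - bv * 0\<^sub>m p p) @\<^sub>c (bu * 0\<^sub>m p p + - bv * (z \<cdot>\<^sub>m 1\<^sub>m p))"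
      unfolding Z by (rule append_cols_mult_four_block_mat) auto
    also have "bu * 1\<^sub>m p + - bv * 0\<^sub>m p p = bu" by simp
    also have "- bv * (z \<cdot>\<^sub>m 1\<^sub>m p) = z \<cdot>\<^sub>m (- bv * 1\<^sub>m p)"
      by (rule mult_smult_distrib[of _ \<delta> p _ p]) auto
    also have "bu * 0\<^sub>m p p + z \<cdot>\<^sub>m (- bv * 1\<^sub>m p) = - (z \<cdot>\<^sub>m bv)"
      by (rule eq_matI) auto
    finally show ?thesis .
  qed
  have "au * R \<in> carrier_mat p \<delta>" by (rule mult_carrier_mat[of _ p \<delta>]) auto
  then have auR: "au * R * - (z \<cdot>\<^sub>m bv) = - (z \<cdot>\<^sub>m (au * R * bv))"
    using uminus_mult_right_mat[of "au * R" "z \<cdot>\<^sub>m bv"] mult_smult_distrib[of "au * R" p \<delta> bv p z]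
    by (simp del: assoc_mult_mat)
  have "av * R \<in> carrier_mat p \<delta>" by (rule mult_carrier_mat[of _ p \<delta>]) auto
  then have avR: "av * R * - (z \<cdot>\<^sub>m bv) = - (z \<cdot>\<^sub>m (av * R * bv))"
    using uminus_mult_right_mat[of "av * R" "z \<cdot>\<^sub>m bv"] mult_smult_distrib[of "av * R" p \<delta> bv p z]
    by (simp del: assoc_mult_mat)
  have L: "(au @\<^sub>r av) * R \<in> carrier_mat (p + p) \<delta>"
    and b: "bu @\<^sub>c bv \<in> carrier_mat \<delta> (p + p)" unfolding aR
    by (auto intro!: carrier_append_rows mult_carrier_mat[of _ p \<delta>])
  have "(au @\<^sub>r av) * R * (bu @\<^sub>c bv) * ?J * ?Z = (au @\<^sub>r av) * R * ((bu @\<^sub>c bv) * ?J * ?Z)"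
    by (simp only: assoc_mult_mat[OF L b Jc] assoc_mult_mat[OF L mult_carrier_mat[OF b Jc] Zc])
  also have "\<dots> = ((au * R) @\<^sub>r (av * R)) * (bu @\<^sub>c (- (z \<cdot>\<^sub>m bv)))"
    by (simp only: bJ bJZ aR)
  also have "\<dots> = (((au * R) @\<^sub>r (av * R)) * bu) @\<^sub>c (((au * R) @\<^sub>r (av * R)) * (- (z \<cdot>\<^sub>m bv)))"
    by (rule mult_append_cols[OF L[unfolded aR]]) auto
  also have "((au * R) @\<^sub>r (av * R)) * bu = (au * R * bu) @\<^sub>r (av * R * bu)"
    by (rule append_rows_mult[of _ p \<delta>]) auto
  also have "((au * R) @\<^sub>r (av * R)) * (- (z \<cdot>\<^sub>m bv)) = (au * R * - (z \<cdot>\<^sub>m bv)) @\<^sub>r (av * R * - (z \<cdot>\<^sub>m bv))"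
    by (rule append_rows_mult[of _ p \<delta>]) auto
  also have "au * R * - (z \<cdot>\<^sub>m bv) = - (z \<cdot>\<^sub>m (au * R * bv))"
    by fact
  also have "av * R * - (z \<cdot>\<^sub>m bv) = - (z \<cdot>\<^sub>m (av * R * bv))"
    by fact
  also have "((au * R * bu) @\<^sub>r (av * R * bu)) @\<^sub>c (- (z \<cdot>\<^sub>m (au * R * bv)) @\<^sub>r - (z \<cdot>\<^sub>m (av * R * bv))) =
      four_block_mat (au * R * bu) (- (z \<cdot>\<^sub>m (au * R * bv))) (av * R * bu) (- (z \<cdot>\<^sub>m (av * R * bv)))"
    by (rule append_cols_append_rows[of _ p p _ p _ p]) auto
  finally have prod: "(au @\<^sub>r av) * R * (bu @\<^sub>c bv) * ?J * ?Z = \<dots>" .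
  show ?thesis
    unfolding prod
    by (rule eq_matI) (auto simp: Let_def)
qed

section \<open>Transforming a realization\<close>

lemma transfer_function_carrier [simp]:
  assumes "A \<in> carrier_mat k k" "B \<in> carrier_mat k p" "C \<in> carrier_mat p k" "D \<in> carrier_mat p p"
  shows "transfer_function k A B C D \<in> carrier_mat p p"
  using assms resolvent(1)[OF assms(1)] by (auto simp: transfer_function_def)

text \<open>
  Transfer functions are handled through the linear system \<open>z X = A X + B Y\<close>, \<open>out = C X + D Y\<close> that
  they eliminate: since \<open>z I - A\<close> is invertible, any \<open>X\<close> that solves the state equation is the
  state, whatever way it was found. This replaces manipulations of resolvents of block matrices by
  the verification of one linear equation.
\<close>

lemma transfer_function_of_state_equation:
  assumes A: "A \<in> carrier_mat k k" and B: "B \<in> carrier_mat k p"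
    and C: "C \<in> carrier_mat p k" and D: "D \<in> carrier_mat p p"
    and X: "X \<in> carrier_mat k m" and Y: "Y \<in> carrier_mat p m"
    and state: "const_mat B * Y + const_mat A * X = ratvar \<cdot>\<^sub>m X"
  shows "X = inv_mat (ratvar \<cdot>\<^sub>m 1\<^sub>m k - const_mat A) * const_mat B * Y"
    and "const_mat D * Y + const_mat C * X = transfer_function k A B C D * Y"
proof -
  let ?P = "ratvar \<cdot>\<^sub>m 1\<^sub>m k - const_mat A" and ?R = "inv_mat (ratvar \<cdot>\<^sub>m 1\<^sub>m k - const_mat A)"
  note R = resolvent[OF A]
  note carr = A B C D X Y R(1)
  note [simp] = carr[THEN carrier_matD(1)] carr[THEN carrier_matD(2)] carr(1-4)[THEN const_mat_carrier(1)] carr(5-7)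
  have "?P * X = ratvar \<cdot>\<^sub>m 1\<^sub>m k * X - const_mat A * X"
    by (rule minus_mult_distrib_mat) auto
  also have "ratvar \<cdot>\<^sub>m 1\<^sub>m k * X = ratvar \<cdot>\<^sub>m X"
    by (simp add: mult_smult_assoc_mat[of _ k k _ m] left_mult_one_mat[of _ k m])
  also have "\<dots> - const_mat A * X = const_mat B * Y"
    unfolding state[symmetric] by (rule eq_matI) auto
  finally have PX: "?P * X = const_mat B * Y" .
  have "X = ?R * ?P * X" using R(3) X by simp
  also have "\<dots> = ?R * (?P * X)" by (rule assoc_mult_mat) auto
  also have "\<dots> = ?R * const_mat B * Y"
    unfolding PX by (rule assoc_mult_mat[symmetric]) auto
  finally show XX: "X = ?R * const_mat B * Y" .
  have cC: "const_mat C \<in> carrier_mat p k" and cB: "const_mat B \<in> carrier_mat k p" by auto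
  have "transfer_function k A B C D * Y =
      const_mat D * Y + const_mat C * ?R * const_mat B * Y"
    unfolding transfer_function_def by (rule add_mult_distrib_mat) auto
  also have "const_mat C * ?R * const_mat B * Y = const_mat C * (?R * const_mat B * Y)"
    by (simp only: assoc_mult_mat[OF cC R(1) cB] assoc_mult_mat[OF cC mult_carrier_mat[OF R(1) cB] Y])
  finally show "const_mat D * Y + const_mat C * X = transfer_function k A B C D * Y"
    unfolding XX[symmetric] by simp
qed

lemma transfer_function_state:
  assumes A: "A \<in> carrier_mat k k" and B: "B \<in> carrier_mat k p"
    and C: "C \<in> carrier_mat p k" and D: "D \<in> carrier_mat p p"
  obtains X where "X \<in> carrier_mat k p" "const_mat B + const_mat A * X = ratvar \<cdot>\<^sub>m X"
    "transfer_function k A B C D = const_mat D + const_mat C * X"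
proof
  let ?P = "ratvar \<cdot>\<^sub>m 1\<^sub>m k - const_mat A" and ?R = "inv_mat (ratvar \<cdot>\<^sub>m 1\<^sub>m k - const_mat A)"
  let ?X = "?R * const_mat B"
  note R = resolvent[OF A]
  note carr = A B C D R(1)
  note [simp] = carr[THEN carrier_matD(1)] carr[THEN carrier_matD(2)] carr(1-4)[THEN const_mat_carrier(1)] carr(5)
  show X: "?X \<in> carrier_mat k p" by (rule mult_carrier_mat[of _ k k]) auto
  have "?P * ?X = ?P * ?R * const_mat B" by (rule assoc_mult_mat[symmetric]) auto
  also have "\<dots> = const_mat B" using R(2) by simp
  finally have "const_mat B = ?P * ?X" ..
  also have "\<dots> = ratvar \<cdot>\<^sub>m 1\<^sub>m k * ?X - const_mat A * ?X"
    by (rule minus_mult_distrib_mat) auto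
  also have "ratvar \<cdot>\<^sub>m 1\<^sub>m k * ?X = ratvar \<cdot>\<^sub>m ?X"
    using X by (simp add: mult_smult_assoc_mat[of _ k k _ p] left_mult_one_mat[of _ k p])
  finally have *: "const_mat B = ratvar \<cdot>\<^sub>m ?X - const_mat A * ?X" .
  show "const_mat B + const_mat A * ?X = ratvar \<cdot>\<^sub>m ?X"
    by (subst *, rule eq_matI) (use A B R(1) in auto)
  show "transfer_function k A B C D = const_mat D + const_mat C * ?X"
    unfolding transfer_function_def
    by (simp add: assoc_mult_mat[of _ p k _ k _ p])
qed

text \<open>
  The heart of the argument is a composition of signals. Feed the column \<open>(1, T)\<close> into \<open>V\<close> and call the
  outcome \<open>(Den, S)\<close>; the adjoint of \<open>V\<close> undoes this. Hence the three factors of the update send the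
  column \<open>(Den, S, X)\<close>, where \<open>X\<close> is the state of the given system, first to \<open>(1, T, X)\<close>, then by the
  state equation to \<open>(G, T, z X)\<close>, and finally to \<open>(Num, z S, z X)\<close>. So \<open>(S, X)\<close> is a state of the updated
  system with input \<open>Den\<close> and output \<open>Num\<close>, which is the first claim.

  The second claim says that \<open>Den\<close> cannot degenerate: \<open>S\<close> is recovered from \<open>Den\<close> by the state equation
  of the updated system, and the constant input \<open>1\<close> is recovered from \<open>(Den, S)\<close> by the adjoint of \<open>V\<close>.
\<close>

lemma transfer_function_realization_update:
  assumes A: "A \<in> carrier_mat k k" and B: "B \<in> carrier_mat k p"
    and C: "C \<in> carrier_mat p k" and D: "D \<in> carrier_mat p p"
    and U: "U \<in> carrier_mat (p + \<delta>) (p + \<delta>)" and V: "unitary_mat (p + \<delta>) V"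
    and upd: "realization_update p \<delta> U V k A B C D A' B' C' D'"
    and T: "T \<in> carrier_mat \<delta> p" and S: "S \<in> carrier_mat \<delta> p"
    and Den: "Den \<in> carrier_mat p p" and Num: "Num \<in> carrier_mat p p"
    and VT: "const_mat V * (1\<^sub>m p @\<^sub>r T) = Den @\<^sub>r S"
    and UT: "const_mat U * (transfer_function k A B C D @\<^sub>r T) = Num @\<^sub>r (ratvar \<cdot>\<^sub>m S)"
  shows "transfer_function (\<delta> + k) A' B' C' D' * Den = Num"
    and "\<exists>L \<in> carrier_mat p p. L * Den = 1\<^sub>m p"
proof -
  let ?z = "ratvar" and ?W = "mat_adjoint V"
  have V': "V \<in> carrier_mat (p + \<delta>) (p + \<delta>)" "?W * V = 1\<^sub>m (p + \<delta>)"
    using V by (auto simp: unitary_mat_def)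
  have W: "?W \<in> carrier_mat (p + \<delta>) (p + \<delta>)" using V' by simp
  have c': "A' \<in> carrier_mat (\<delta> + k) (\<delta> + k)" "B' \<in> carrier_mat (\<delta> + k) p"
      "C' \<in> carrier_mat p (\<delta> + k)" "D' \<in> carrier_mat p p"
    and E: "four_block_mat D' C' B' A' =
       diag_block_mat [U, 1\<^sub>m k]
       * four_block_mat (diag_block_mat [D, 1\<^sub>m \<delta>]) (C @\<^sub>r 0\<^sub>m \<delta> k) (B @\<^sub>c 0\<^sub>m k \<delta>) A
       * diag_block_mat [?W, 1\<^sub>m k]"
    using upd by (auto simp: realization_update_def)
  obtain X where X: "X \<in> carrier_mat k p" and stX: "const_mat B + const_mat A * X = ?z \<cdot>\<^sub>m X"
    and G: "transfer_function k A B C D = const_mat D + const_mat C * X"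
    using transfer_function_state[OF A B C D] .
  let ?G = "transfer_function k A B C D"
  note cc = A B C D U V'(1) W c'
  note [simp] = cc[THEN const_mat_carrier(1)] cc T S Den Num X
    cc[THEN carrier_matD(1)] cc[THEN carrier_matD(2)] T[THEN carrier_matD(1)] T[THEN carrier_matD(2)]
    S[THEN carrier_matD(1)] S[THEN carrier_matD(2)] X[THEN carrier_matD(1)] X[THEN carrier_matD(2)]
    Den[THEN carrier_matD(1)] Den[THEN carrier_matD(2)] Num[THEN carrier_matD(1)] Num[THEN carrier_matD(2)]
  let ?Y = "S @\<^sub>r X"
  have Y [simp]: "?Y \<in> carrier_mat (\<delta> + k) p" by simp
  have G' [simp]: "?G \<in> carrier_mat p p" by simp
  let ?F1 = "four_block_mat (const_mat U) (0\<^sub>m (p + \<delta>) k) (0\<^sub>m k (p + \<delta>)) (1\<^sub>m k)"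
  let ?F2 = "four_block_mat (four_block_mat (const_mat D) (0\<^sub>m p \<delta>) (0\<^sub>m \<delta> p) (1\<^sub>m \<delta>))
      (const_mat C @\<^sub>r 0\<^sub>m \<delta> k) (const_mat B @\<^sub>c 0\<^sub>m k \<delta>) (const_mat A)"
  let ?F3 = "four_block_mat (const_mat ?W) (0\<^sub>m (p + \<delta>) k) (0\<^sub>m k (p + \<delta>)) (1\<^sub>m k)"
  have E': "four_block_mat (const_mat D') (const_mat C') (const_mat B') (const_mat A') = ?F1 * ?F2 * ?F3"
  proof -
    have d1: "diag_block_mat [U, 1\<^sub>m k] = four_block_mat U (0\<^sub>m (p + \<delta>) k) (0\<^sub>m k (p + \<delta>)) (1\<^sub>m k)"
      by (rule diag_block_mat_pair) auto
    have d2: "diag_block_mat [D, 1\<^sub>m \<delta>] = four_block_mat D (0\<^sub>m p \<delta>) (0\<^sub>m \<delta> p) (1\<^sub>m \<delta>)"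
      by (rule diag_block_mat_pair) auto
    have d3: "diag_block_mat [?W, 1\<^sub>m k] = four_block_mat ?W (0\<^sub>m (p + \<delta>) k) (0\<^sub>m k (p + \<delta>)) (1\<^sub>m k)"
      by (rule diag_block_mat_pair) auto
    let ?f1 = "four_block_mat U (0\<^sub>m (p + \<delta>) k) (0\<^sub>m k (p + \<delta>)) (1\<^sub>m k)"
    let ?f2 = "four_block_mat (four_block_mat D (0\<^sub>m p \<delta>) (0\<^sub>m \<delta> p) (1\<^sub>m \<delta>)) (C @\<^sub>r 0\<^sub>m \<delta> k) (B @\<^sub>c 0\<^sub>m k \<delta>) A"
    let ?f3 = "four_block_mat ?W (0\<^sub>m (p + \<delta>) k) (0\<^sub>m k (p + \<delta>)) (1\<^sub>m k)"
    have f: "?f1 \<in> carrier_mat (p + \<delta> + k) (p + \<delta> + k)" "?f2 \<in> carrier_mat (p + \<delta> + k) (p + \<delta> + k)"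
      "?f3 \<in> carrier_mat (p + \<delta> + k) (p + \<delta> + k)"
      by (intro four_block_carrier_mat; simp)+
    have "four_block_mat (const_mat D') (const_mat C') (const_mat B') (const_mat A') =
        const_mat (four_block_mat D' C' B' A')"
      by (rule const_mat_four_block_mat[symmetric, OF c'(4,3,2,1)])
    also have "\<dots> = const_mat (?f1 * ?f2 * ?f3)" unfolding E d1 d2 d3 ..
    also have "\<dots> = const_mat ?f1 * const_mat ?f2 * const_mat ?f3"
      by (simp only: const_mat_mult[OF f(1,2)] const_mat_mult[OF mult_carrier_mat[OF f(1,2)] f(3)])
    also have "const_mat ?f1 = ?F1"
      by (subst const_mat_four_block_mat[of _ "p + \<delta>" "p + \<delta>" _ k _ k]) (auto simp: const_mat_one const_mat_zero)
    also have "const_mat ?f3 = ?F3"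
      by (subst const_mat_four_block_mat[of _ "p + \<delta>" "p + \<delta>" _ k _ k]) (auto simp: const_mat_one const_mat_zero)
    also have "const_mat ?f2 = ?F2"
    proof -
      have "const_mat ?f2 = four_block_mat (const_mat (four_block_mat D (0\<^sub>m p \<delta>) (0\<^sub>m \<delta> p) (1\<^sub>m \<delta>)))
           (const_mat (C @\<^sub>r 0\<^sub>m \<delta> k)) (const_mat (B @\<^sub>c 0\<^sub>m k \<delta>)) (const_mat A)"
        by (rule const_mat_four_block_mat[of _ "p + \<delta>" "p + \<delta>" _ k _ k]) auto
      also have "const_mat (four_block_mat D (0\<^sub>m p \<delta>) (0\<^sub>m \<delta> p) (1\<^sub>m \<delta>)) =
          four_block_mat (const_mat D) (0\<^sub>m p \<delta>) (0\<^sub>m \<delta> p) (1\<^sub>m \<delta>)"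
        by (subst const_mat_four_block_mat[of _ p p _ \<delta> _ \<delta>]) (auto simp: const_mat_one const_mat_zero)
      also have "const_mat (C @\<^sub>r 0\<^sub>m \<delta> k) = const_mat C @\<^sub>r 0\<^sub>m \<delta> k"
        by (subst const_mat_append_rows[of _ p k _ \<delta>]) (auto simp: const_mat_zero)
      also have "const_mat (B @\<^sub>c 0\<^sub>m k \<delta>) = const_mat B @\<^sub>c 0\<^sub>m k \<delta>"
        by (subst const_mat_append_cols[of _ k p _ \<delta>]) (auto simp: const_mat_zero)
      finally show ?thesis .
    qed
    finally show ?thesis .
  qed
  have F: "?F1 \<in> carrier_mat (p + \<delta> + k) (p + \<delta> + k)" "?F2 \<in> carrier_mat (p + \<delta> + k) (p + \<delta> + k)"
      "?F3 \<in> carrier_mat (p + \<delta> + k) (p + \<delta> + k)"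
    by (intro four_block_carrier_mat; simp)+
  have WDS: "const_mat ?W * (Den @\<^sub>r S) = 1\<^sub>m p @\<^sub>r T"
  proof -
    have 1: "(1\<^sub>m p @\<^sub>r T) \<in> carrier_mat (p + \<delta>) p" by auto
    have "const_mat ?W * (Den @\<^sub>r S) = const_mat ?W * const_mat V * (1\<^sub>m p @\<^sub>r T)"
      unfolding VT[symmetric] by (rule assoc_mult_mat[symmetric, OF _ _ 1]) auto
    also have "const_mat ?W * const_mat V = 1\<^sub>m (p + \<delta>)"
      using const_mat_mult[OF W V'(1)] V'(2) by (simp add: const_mat_one)
    finally show ?thesis using 1 by simp
  qed
  have s3: "?F3 * ((Den @\<^sub>r S) @\<^sub>r X) = (1\<^sub>m p @\<^sub>r T) @\<^sub>r X"
  proof -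
    have "?F3 * ((Den @\<^sub>r S) @\<^sub>r X) = (const_mat ?W * (Den @\<^sub>r S) + 0\<^sub>m (p + \<delta>) k * X) @\<^sub>r
        (0\<^sub>m k (p + \<delta>) * (Den @\<^sub>r S) + 1\<^sub>m k * X)"
      by (rule four_block_mat_mult_append_rows) auto
    also have "const_mat ?W * (Den @\<^sub>r S) + 0\<^sub>m (p + \<delta>) k * X = 1\<^sub>m p @\<^sub>r T"
      unfolding WDS by (simp add: right_add_zero_mat[of _ "p + \<delta>" p])
    also have "0\<^sub>m k (p + \<delta>) * (Den @\<^sub>r S) + 1\<^sub>m k * X = X"
      by (simp add: left_mult_zero_mat[of _ "p + \<delta>" p] left_add_zero_mat[of _ k p])
    finally show ?thesis .
  qed
  have s2: "?F2 * ((1\<^sub>m p @\<^sub>r T) @\<^sub>r X) = (?G @\<^sub>r T) @\<^sub>r (?z \<cdot>\<^sub>m X)"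
  proof -
    let ?DI = "four_block_mat (const_mat D) (0\<^sub>m p \<delta>) (0\<^sub>m \<delta> p) (1\<^sub>m \<delta>)"
    have "?F2 * ((1\<^sub>m p @\<^sub>r T) @\<^sub>r X) = (?DI * (1\<^sub>m p @\<^sub>r T) + (const_mat C @\<^sub>r 0\<^sub>m \<delta> k) * X) @\<^sub>r
        ((const_mat B @\<^sub>c 0\<^sub>m k \<delta>) * (1\<^sub>m p @\<^sub>r T) + const_mat A * X)"
      by (rule four_block_mat_mult_append_rows) auto
    also have "?DI * (1\<^sub>m p @\<^sub>r T) = (const_mat D * 1\<^sub>m p + 0\<^sub>m p \<delta> * T) @\<^sub>r (0\<^sub>m \<delta> p * 1\<^sub>m p + 1\<^sub>m \<delta> * T)"
      by (rule four_block_mat_mult_append_rows) auto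
    also have "const_mat D * 1\<^sub>m p + 0\<^sub>m p \<delta> * T = const_mat D"
      by (simp add: left_mult_zero_mat[of _ \<delta> p] right_mult_one_mat[of _ p p] right_add_zero_mat[of _ p p])
    also have "0\<^sub>m \<delta> p * 1\<^sub>m p + 1\<^sub>m \<delta> * T = T"
      by (simp add: left_mult_one_mat[of _ \<delta> p] left_add_zero_mat[of _ \<delta> p])
    also have "(const_mat C @\<^sub>r 0\<^sub>m \<delta> k) * X = (const_mat C * X) @\<^sub>r (0\<^sub>m \<delta> k * X)"
      by (rule append_rows_mult) auto
    also have "0\<^sub>m \<delta> k * X = 0\<^sub>m \<delta> p" by simp
    also have "(const_mat D @\<^sub>r T) + ((const_mat C * X) @\<^sub>r 0\<^sub>m \<delta> p) = (const_mat D + const_mat C * X) @\<^sub>r (T + 0\<^sub>m \<delta> p)"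
      by (rule append_rows_add) auto
    also have "T + 0\<^sub>m \<delta> p = T" by (simp add: right_add_zero_mat[of _ \<delta> p])
    also have "(const_mat B @\<^sub>c 0\<^sub>m k \<delta>) * (1\<^sub>m p @\<^sub>r T) = const_mat B * 1\<^sub>m p + 0\<^sub>m k \<delta> * T"
      by (rule append_cols_mult_append_rows) auto
    also have "const_mat B * 1\<^sub>m p + 0\<^sub>m k \<delta> * T = const_mat B"
      by (simp add: left_mult_zero_mat[of _ \<delta> p] right_mult_one_mat[of _ k p] right_add_zero_mat[of _ k p])
    finally show ?thesis unfolding stX G .
  qed
  have s1: "?F1 * ((?G @\<^sub>r T) @\<^sub>r (?z \<cdot>\<^sub>m X)) = (Num @\<^sub>r ?z \<cdot>\<^sub>m S) @\<^sub>r (?z \<cdot>\<^sub>m X)"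
  proof -
    have "?F1 * ((?G @\<^sub>r T) @\<^sub>r (?z \<cdot>\<^sub>m X)) = (const_mat U * (?G @\<^sub>r T) + 0\<^sub>m (p + \<delta>) k * (?z \<cdot>\<^sub>m X)) @\<^sub>r
        (0\<^sub>m k (p + \<delta>) * (?G @\<^sub>r T) + 1\<^sub>m k * (?z \<cdot>\<^sub>m X))"
      by (rule four_block_mat_mult_append_rows) auto
    also have "const_mat U * (?G @\<^sub>r T) + 0\<^sub>m (p + \<delta>) k * (?z \<cdot>\<^sub>m X) = Num @\<^sub>r ?z \<cdot>\<^sub>m S"
      unfolding UT by (simp add: left_mult_zero_mat[of _ k p] right_add_zero_mat[of _ "p + \<delta>" p])
    also have "0\<^sub>m k (p + \<delta>) * (?G @\<^sub>r T) + 1\<^sub>m k * (?z \<cdot>\<^sub>m X) = ?z \<cdot>\<^sub>m X"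
      by (simp add: left_mult_zero_mat[of _ "p + \<delta>" p] left_add_zero_mat[of _ k p] left_mult_one_mat[of _ k p])
    finally show ?thesis .
  qed
  have DSX: "(Den @\<^sub>r S) @\<^sub>r X \<in> carrier_mat (p + \<delta> + k) p" by simp
  have F3X: "?F3 * ((Den @\<^sub>r S) @\<^sub>r X) \<in> carrier_mat (p + \<delta> + k) p" by (rule mult_carrier_mat[OF F(3) DSX])
  have "(const_mat D' * Den + const_mat C' * ?Y) @\<^sub>r (const_mat B' * Den + const_mat A' * ?Y) =
      four_block_mat (const_mat D') (const_mat C') (const_mat B') (const_mat A') * (Den @\<^sub>r ?Y)"
    by (rule four_block_mat_mult_append_rows[symmetric]) auto
  also have "\<dots> = ?F1 * ?F2 * ?F3 * ((Den @\<^sub>r S) @\<^sub>r X)"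
    unfolding E' by (subst append_rows_assoc) auto
  also have "\<dots> = ?F1 * ?F2 * (?F3 * ((Den @\<^sub>r S) @\<^sub>r X))"
    by (rule assoc_mult_mat[OF mult_carrier_mat[OF F(1,2)] F(3) DSX])
  also have "\<dots> = ?F1 * (?F2 * (?F3 * ((Den @\<^sub>r S) @\<^sub>r X)))"
    by (rule assoc_mult_mat[OF F(1,2) F3X])
  also have "\<dots> = (Num @\<^sub>r ?z \<cdot>\<^sub>m S) @\<^sub>r (?z \<cdot>\<^sub>m X)"
    unfolding s3 s2 s1 ..
  also have "\<dots> = Num @\<^sub>r (?z \<cdot>\<^sub>m S @\<^sub>r ?z \<cdot>\<^sub>m X)"
    by (rule append_rows_assoc) auto
  also have "?z \<cdot>\<^sub>m S @\<^sub>r ?z \<cdot>\<^sub>m X = ?z \<cdot>\<^sub>m ?Y"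
    by (rule append_rows_smult[symmetric]) auto
  finally have stacked: "(const_mat D' * Den + const_mat C' * ?Y) @\<^sub>r (const_mat B' * Den + const_mat A' * ?Y) =
      Num @\<^sub>r (?z \<cdot>\<^sub>m ?Y)" .
  have CY: "const_mat C' * ?Y \<in> carrier_mat p p" and AY: "const_mat A' * ?Y \<in> carrier_mat (\<delta> + k) p"
    by (rule mult_carrier_mat[OF _ Y], simp)+
  have out: "const_mat D' * Den + const_mat C' * ?Y = Num"
    by (rule append_rows_inject(1)[of _ p p _ _ "\<delta> + k", OF _ _ _ _ stacked]) (use CY AY in auto)
  have state: "const_mat B' * Den + const_mat A' * ?Y = ?z \<cdot>\<^sub>m ?Y"
    by (rule append_rows_inject(2)[of _ p p _ _ "\<delta> + k", OF _ _ _ _ stacked]) (use CY AY in auto)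
  note tf = transfer_function_of_state_equation[OF c' Y Den state]
  show "transfer_function (\<delta> + k) A' B' C' D' * Den = Num"
    using tf(2) out by simp

  let ?Q = "inv_mat (?z \<cdot>\<^sub>m 1\<^sub>m (\<delta> + k) - const_mat A') * const_mat B'"
  have Q: "?Q \<in> carrier_mat (\<delta> + k) p" using resolvent(1)[OF c'(1)] by simp
  \<comment> \<open>The first block row of \<open>V\<^sup>* (Den, S) = (1, T)\<close> becomes a left inverse once \<open>S\<close> is expressed by \<open>Den\<close>.\<close>
  obtain W1 W2 W3 W4 where sb: "split_block (const_mat ?W) p p = (W1, W2, W3, W4)"
    by (metis prod_cases4)
  have dims: "dim_row (const_mat ?W) = p + \<delta>" "dim_col (const_mat ?W) = p + \<delta>" using W by auto
  note Ws = split_block[OF sb dims]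
  have "(W1 * Den + W2 * S) @\<^sub>r (W3 * Den + W4 * S) = const_mat ?W * (Den @\<^sub>r S)"
    unfolding Ws(5) by (rule four_block_mat_mult_append_rows[symmetric]) (use Ws(1-4) in auto)
  also note WDS
  finally have "(W1 * Den + W2 * S) @\<^sub>r (W3 * Den + W4 * S) = 1\<^sub>m p @\<^sub>r T" .
  then have one: "W1 * Den + W2 * S = 1\<^sub>m p"
    by (rule append_rows_inject(1)[of _ p p _ _ \<delta>, rotated 4]) (use Ws(1-4) in auto)
  let ?P = "1\<^sub>m \<delta> @\<^sub>c 0\<^sub>m \<delta> k :: ratfun mat"
  have P: "?P \<in> carrier_mat \<delta> (\<delta> + k)" by auto
  have "S = ?P * ?Y"
    by (subst append_cols_mult_append_rows) (auto simp: left_mult_one_mat[of _ \<delta> p] right_add_zero_mat[of _ \<delta> p])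
  also have "\<dots> = ?P * (?Q * Den)" using tf(1) by simp
  also have "\<dots> = ?P * ?Q * Den" by (rule assoc_mult_mat[symmetric, OF P Q Den])
  finally have "W2 * S = W2 * (?P * ?Q * Den)" by simp
  also have "\<dots> = W2 * (?P * ?Q) * Den"
    by (rule assoc_mult_mat[symmetric, OF Ws(2) mult_carrier_mat[OF P Q] Den])
  finally have "(W1 + W2 * (?P * ?Q)) * Den = W1 * Den + W2 * S"
    using add_mult_distrib_mat[OF Ws(1) mult_carrier_mat[OF Ws(2) mult_carrier_mat[OF P Q]] Den] by simp
  with one have "(W1 + W2 * (?P * ?Q)) * Den = 1\<^sub>m p" by simp
  moreover have "W1 + W2 * (?P * ?Q) \<in> carrier_mat p p"
    using Ws(1) mult_carrier_mat[OF Ws(2) mult_carrier_mat[OF P Q]] by simp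
  ultimately show "\<exists>L \<in> carrier_mat p p. L * Den = 1\<^sub>m p" by blast
qed

section \<open>Existence of realizations\<close>

text \<open>
  A proper rational function is built from constants and the functions \<open>1 / (z - a)\<close> by sums and products,
  because the denominator splits into linear factors. It therefore suffices that realizable matrices
  are closed under sums, constant multiples and multiplication by \<open>1 / (z - a)\<close>; a matrix is then
  assembled entry by entry from the constant matrix units.
\<close>

definition realizable :: "nat \<Rightarrow> ratfun mat \<Rightarrow> bool" where
  "realizable p G \<longleftrightarrow> (\<exists>k A B C D. is_realization p k A B C D G)"

lemma realizable_carrier: "realizable p G \<Longrightarrow> G \<in> carrier_mat p p"
  unfolding realizable_def is_realization_def by auto

text \<open>
  Exhibiting the state \<open>X\<close> of a candidate system avoids inverting its state matrix; in the closure
  properties below the state is always known in advance.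
\<close>

lemma realizableI:
  assumes A: "A \<in> carrier_mat k k" and B: "B \<in> carrier_mat k p"
    and C: "C \<in> carrier_mat p k" and D: "D \<in> carrier_mat p p"
    and X: "X \<in> carrier_mat k p"
    and state: "const_mat B + const_mat A * X = ratvar \<cdot>\<^sub>m X"
    and G: "G = const_mat D + const_mat C * X"
  shows "realizable p G"
proof -
  have one: "1\<^sub>m p \<in> carrier_mat p p" by simp
  have state': "const_mat B * 1\<^sub>m p + const_mat A * X = ratvar \<cdot>\<^sub>m X"
    using state B by (simp add: right_mult_one_mat[of _ k p])
  have "const_mat D * 1\<^sub>m p + const_mat C * X = transfer_function k A B C D * 1\<^sub>m p"
    by (rule transfer_function_of_state_equation(2)[OF A B C D X one state'])
  then have "G = transfer_function k A B C D"
    using D transfer_function_carrier[OF A B C D] G by (simp add: right_mult_one_mat[of _ p p])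
  then show ?thesis
    unfolding realizable_def is_realization_def using A B C D by blast
qed

lemma realizableE:
  assumes "realizable p G"
  obtains k A B C D X where "A \<in> carrier_mat k k" "B \<in> carrier_mat k p"
    "C \<in> carrier_mat p k" "D \<in> carrier_mat p p" "X \<in> carrier_mat k p"
    "const_mat B + const_mat A * X = ratvar \<cdot>\<^sub>m X" "G = const_mat D + const_mat C * X"
proof -
  obtain k A B C D where c: "A \<in> carrier_mat k k" "B \<in> carrier_mat k p"
    "C \<in> carrier_mat p k" "D \<in> carrier_mat p p" and G: "G = transfer_function k A B C D"
    using assms unfolding realizable_def is_realization_def by auto
  obtain X where "X \<in> carrier_mat k p" "const_mat B + const_mat A * X = ratvar \<cdot>\<^sub>m X"
    "transfer_function k A B C D = const_mat D + const_mat C * X"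
    using transfer_function_state[OF c] .
  with c G that show thesis by simp
qed

lemma realizable_const_mat:
  assumes D: "D \<in> carrier_mat p p"
  shows "realizable p (const_mat D)"
proof (rule realizableI[of "0\<^sub>m 0 0" 0 "0\<^sub>m 0 p" p "0\<^sub>m p 0" D "0\<^sub>m 0 p"])
  show "const_mat (0\<^sub>m 0 p) + const_mat (0\<^sub>m 0 0) * 0\<^sub>m 0 p = ratvar \<cdot>\<^sub>m 0\<^sub>m 0 p"
    by (rule eq_matI) auto
  show "const_mat D = const_mat D + const_mat (0\<^sub>m p 0) * 0\<^sub>m 0 p"
    by (rule eq_matI) (use D in \<open>auto simp: scalar_prod_def\<close>)
qed (use D in auto)

text \<open>
  Two systems in parallel: the states are stacked.
\<close>

lemma realizable_add:
  assumes G1: "realizable p G1" and G2: "realizable p G2"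
  shows "realizable p (G1 + G2)"
proof -
  obtain k1 A1 B1 C1 D1 X1 where 1: "A1 \<in> carrier_mat k1 k1" "B1 \<in> carrier_mat k1 p"
    "C1 \<in> carrier_mat p k1" "D1 \<in> carrier_mat p p" "X1 \<in> carrier_mat k1 p"
    and st1: "const_mat B1 + const_mat A1 * X1 = ratvar \<cdot>\<^sub>m X1" and g1: "G1 = const_mat D1 + const_mat C1 * X1"
    using realizableE[OF G1] .
  obtain k2 A2 B2 C2 D2 X2 where 2: "A2 \<in> carrier_mat k2 k2" "B2 \<in> carrier_mat k2 p"
    "C2 \<in> carrier_mat p k2" "D2 \<in> carrier_mat p p" "X2 \<in> carrier_mat k2 p"
    and st2: "const_mat B2 + const_mat A2 * X2 = ratvar \<cdot>\<^sub>m X2" and g2: "G2 = const_mat D2 + const_mat C2 * X2"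
    using realizableE[OF G2] .
  let ?A = "four_block_mat A1 (0\<^sub>m k1 k2) (0\<^sub>m k2 k1) A2" and ?X = "X1 @\<^sub>r X2"
  note c1 = 1(1-4)[THEN const_mat_carrier(1)] and c2 = 2(1-4)[THEN const_mat_carrier(1)]
  show ?thesis
  proof (rule realizableI[of ?A "k1 + k2" "B1 @\<^sub>r B2" p "C1 @\<^sub>c C2" "D1 + D2" ?X])
    have AX: "const_mat ?A * ?X = (const_mat A1 * X1) @\<^sub>r (const_mat A2 * X2)"
    proof -
      have "const_mat ?A = four_block_mat (const_mat A1) (0\<^sub>m k1 k2) (0\<^sub>m k2 k1) (const_mat A2)"
        using const_mat_four_block_mat[OF 1(1) zero_carrier_mat[of k1 k2] zero_carrier_mat[of k2 k1] 2(1)]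
        by (simp add: const_mat_zero)
      also have "\<dots> * ?X = (const_mat A1 * X1 + 0\<^sub>m k1 k2 * X2) @\<^sub>r (0\<^sub>m k2 k1 * X1 + const_mat A2 * X2)"
        by (rule four_block_mat_mult_append_rows[OF c1(1) _ _ c2(1) 1(5) 2(5)]) auto
      also have "const_mat A1 * X1 + 0\<^sub>m k1 k2 * X2 = const_mat A1 * X1"
        using 1 2 by (intro eq_matI) auto
      also have "0\<^sub>m k2 k1 * X1 + const_mat A2 * X2 = const_mat A2 * X2"
        using 1 2 by (intro eq_matI) auto
      finally show ?thesis .
    qed
    have "const_mat (B1 @\<^sub>r B2) + const_mat ?A * ?X =
      (const_mat B1 + const_mat A1 * X1) @\<^sub>r (const_mat B2 + const_mat A2 * X2)"
      unfolding AX const_mat_append_rows[OF 1(2) 2(2)]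
      by (rule append_rows_add[OF c1(2) c2(2) mult_carrier_mat[OF c1(1) 1(5)] mult_carrier_mat[OF c2(1) 2(5)]])
    also have "\<dots> = ratvar \<cdot>\<^sub>m ?X"
      unfolding st1 st2 by (rule append_rows_smult[symmetric, OF 1(5) 2(5)])
    finally show "const_mat (B1 @\<^sub>r B2) + const_mat ?A * ?X = ratvar \<cdot>\<^sub>m ?X" .
    have "const_mat (C1 @\<^sub>c C2) * ?X = const_mat C1 * X1 + const_mat C2 * X2"
      unfolding const_mat_append_cols[OF 1(3) 2(3)]
      by (rule append_cols_mult_append_rows[OF c1(3) c2(3) 1(5) 2(5)])
    then show "G1 + G2 = const_mat (D1 + D2) + const_mat (C1 @\<^sub>c C2) * ?X"
      unfolding g1 g2 const_mat_add[OF 1(4) 2(4)] using 1 2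
      by (intro eq_matI) auto
  qed (use 1 2 in auto)
qed

lemma realizable_smult_const:
  assumes G: "realizable p G"
  shows "realizable p (to_fract [:c:] \<cdot>\<^sub>m G)"
proof -
  obtain k A B C D X where *: "A \<in> carrier_mat k k" "B \<in> carrier_mat k p"
    "C \<in> carrier_mat p k" "D \<in> carrier_mat p p" "X \<in> carrier_mat k p"
    and st: "const_mat B + const_mat A * X = ratvar \<cdot>\<^sub>m X" and g: "G = const_mat D + const_mat C * X"
    using realizableE[OF G] .
  show ?thesis
  proof (rule realizableI[OF *(1,2) _ _ *(5) st])
    show "to_fract [:c:] \<cdot>\<^sub>m G = const_mat (c \<cdot>\<^sub>m D) + const_mat (c \<cdot>\<^sub>m C) * X"
      unfolding g const_mat_smult using *
      by (intro eq_matI) (auto simp: distrib_left)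
  qed (use * in auto)
qed

text \<open>
  An additional integrator with pole \<open>a\<close>, driven by the output \<open>G = D + C X\<close>: its state \<open>g = G / (z - a)\<close>
  satisfies \<open>z g = a g + D + C X\<close>, and it is taken as the new output.
\<close>

lemma realizable_divide_linear:
  assumes G: "realizable p G"
  shows "realizable p ((1 / to_fract [:- a, 1:]) \<cdot>\<^sub>m G)"
proof -
  obtain k A B C D X where *: "A \<in> carrier_mat k k" "B \<in> carrier_mat k p"
    "C \<in> carrier_mat p k" "D \<in> carrier_mat p p" "X \<in> carrier_mat k p"
    and st: "const_mat B + const_mat A * X = ratvar \<cdot>\<^sub>m X" and g: "G = const_mat D + const_mat C * X"
    using realizableE[OF G] .
  let ?g = "1 / to_fract [:- a, 1:] :: ratfun" and ?a = "to_fract [:a:]"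
  have "to_fract [:- a, 1:] = ratvar - ?a"
    by (simp add: ratvar_def flip: to_fract_diff)
  moreover have "to_fract [:- a, 1:] \<noteq> (0 :: ratfun)" by simp
  ultimately have "(ratvar - ?a) * ?g = 1" by simp
  then have zg: "ratvar * (?g * y) = y + ?a * (?g * y)" for y
    by (metis (no_types, lifting) ab_group_add_class.ab_diff_conv_add_uminus add.commute diff_add_cancel left_diff_distrib mult.assoc mult_1)
  have Gc: "G \<in> carrier_mat p p" by (rule realizable_carrier[OF G])
  note c = *(1-4)[THEN const_mat_carrier(1)]
  let ?A = "four_block_mat (a \<cdot>\<^sub>m 1\<^sub>m p) C (0\<^sub>m k p) A" and ?X = "(?g \<cdot>\<^sub>m G) @\<^sub>r X"
  have gG: "?g \<cdot>\<^sub>m G \<in> carrier_mat p p" using Gc by simp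
  show ?thesis
  proof (rule realizableI[of ?A "p + k" "D @\<^sub>r B" p "1\<^sub>m p @\<^sub>c 0\<^sub>m p k" "0\<^sub>m p p" ?X])
    have a1: "const_mat (a \<cdot>\<^sub>m 1\<^sub>m p) \<in> carrier_mat p p" by simp
    have z: "const_mat (0\<^sub>m k p) \<in> carrier_mat k p" by simp
    have "const_mat ?A * ?X = (const_mat (a \<cdot>\<^sub>m 1\<^sub>m p) * (?g \<cdot>\<^sub>m G) + const_mat C * X) @\<^sub>r
        (const_mat (0\<^sub>m k p) * (?g \<cdot>\<^sub>m G) + const_mat A * X)"
      using const_mat_four_block_mat[OF _ *(3) _ *(1), of "a \<cdot>\<^sub>m 1\<^sub>m p" p "0\<^sub>m k p"]
      by (simp add: four_block_mat_mult_append_rows[OF a1 c(3) z c(1) gG *(5)])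
    also have "const_mat (a \<cdot>\<^sub>m 1\<^sub>m p) * (?g \<cdot>\<^sub>m G) = ?a \<cdot>\<^sub>m (?g \<cdot>\<^sub>m G)"
      unfolding const_mat_smult const_mat_one
      by (simp add: mult_smult_assoc_mat[OF one_carrier_mat gG] left_mult_one_mat[OF gG])
    also have "const_mat (0\<^sub>m k p) * (?g \<cdot>\<^sub>m G) + const_mat A * X = const_mat A * X"
      unfolding const_mat_zero left_mult_zero_mat[OF gG] using * by (intro eq_matI) auto
    finally have AX: "const_mat ?A * ?X = (?a \<cdot>\<^sub>m (?g \<cdot>\<^sub>m G) + const_mat C * X) @\<^sub>r (const_mat A * X)" .
    have cx: "?a \<cdot>\<^sub>m (?g \<cdot>\<^sub>m G) + const_mat C * X \<in> carrier_mat p p" using * gG by auto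
    have "const_mat (D @\<^sub>r B) + const_mat ?A * ?X =
      (const_mat D + (?a \<cdot>\<^sub>m (?g \<cdot>\<^sub>m G) + const_mat C * X)) @\<^sub>r (const_mat B + const_mat A * X)"
      unfolding AX const_mat_append_rows[OF *(4,2)]
      by (rule append_rows_add[OF c(4,2) cx mult_carrier_mat[OF c(1) *(5)]])
    also have "const_mat D + (?a \<cdot>\<^sub>m (?g \<cdot>\<^sub>m G) + const_mat C * X) = G + ?a \<cdot>\<^sub>m (?g \<cdot>\<^sub>m G)"
      unfolding g using * by (intro eq_matI) auto
    also have "\<dots> = ratvar \<cdot>\<^sub>m (?g \<cdot>\<^sub>m G)"
      by (rule eq_matI) (use zg carrier_matD[OF Gc] in \<open>auto simp del: times_divide_eq_left\<close>)
    also have "const_mat B + const_mat A * X = ratvar \<cdot>\<^sub>m X" by (rule st)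
    also have "(ratvar \<cdot>\<^sub>m (?g \<cdot>\<^sub>m G)) @\<^sub>r (ratvar \<cdot>\<^sub>m X) = ratvar \<cdot>\<^sub>m ?X"
      by (rule append_rows_smult[symmetric, OF gG *(5)])
    finally show "const_mat (D @\<^sub>r B) + const_mat ?A * ?X = ratvar \<cdot>\<^sub>m ?X" .
    have "const_mat (1\<^sub>m p @\<^sub>c 0\<^sub>m p k) = 1\<^sub>m p @\<^sub>c 0\<^sub>m p k"
      using const_mat_append_cols[of "1\<^sub>m p" p p "0\<^sub>m p k" k] by (simp add: const_mat_one const_mat_zero)
    then have "const_mat (1\<^sub>m p @\<^sub>c 0\<^sub>m p k) * ?X = 1\<^sub>m p * (?g \<cdot>\<^sub>m G) + 0\<^sub>m p k * X"
      using append_cols_mult_append_rows[OF one_carrier_mat[of p] zero_carrier_mat[of p k] gG *(5)] by simp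
    then show "?g \<cdot>\<^sub>m G = const_mat (0\<^sub>m p p) + const_mat (1\<^sub>m p @\<^sub>c 0\<^sub>m p k) * ?X"
      unfolding const_mat_zero using * gG by (intro eq_matI) (auto simp: left_mult_one_mat[OF gG] simp del: times_divide_eq_left)
  qed (use * gG in auto)
qed

text \<open>
  Induction on the degree of the denominator. If \<open>d = (z - a) d'\<close> and \<open>n = (z - a) n' + c\<close>, then
  \<open>n / d = n' / d' + c / (z - a) \<cdot> (1 / d')\<close>, where both fractions over \<open>d'\<close> are again proper.
\<close>

lemma realizable_smult_fraction:
  fixes n d :: "complex poly"
  assumes "d \<noteq> 0" "degree n \<le> degree d" "realizable p G"
  shows "realizable p ((to_fract n / to_fract d) \<cdot>\<^sub>m G)"
  using assms
proof (induction "degree d" arbitrary: n d)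
  case 0
  obtain c b where n: "n = [:c:]" and d: "d = [:b:]"
    using 0 by (metis degree_eq_zeroE le_zero_eq)
  have "b \<noteq> 0" using 0 d by auto
  then have "to_fract [:c:] = to_fract [:c / b:] * (to_fract [:b:] :: ratfun)"
    by (simp flip: const_ratfun.hom_mult)
  then have "to_fract n / to_fract d = (to_fract [:c / b:] :: ratfun)"
    using \<open>b \<noteq> 0\<close> unfolding n d by (simp add: field_simps)
  then show ?case using realizable_smult_const[OF 0(4)] by simp
next
  case (Suc m)
  have "\<not> constant (poly d)" using Suc(2) by (simp add: constant_degree)
  then obtain a where a: "poly d a = 0" using fundamental_theorem_of_algebra by blast
  then have "[:- a, 1:] dvd d" by (simp only: poly_eq_0_iff_dvd)
  then obtain d' where d: "d = [:- a, 1:] * d'" by (rule dvdE)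
  have d'0: "d' \<noteq> 0" using Suc(3) d by auto
  have degd: "degree d = Suc (degree d')" unfolding d by (subst degree_mult_eq) (use d'0 in auto)
  define c where "c = poly n a"
  have "poly (n - [:c:]) a = 0" by (simp add: c_def)
  then have "[:- a, 1:] dvd n - [:c:]" by (simp only: poly_eq_0_iff_dvd)
  then obtain n' where n': "n - [:c:] = [:- a, 1:] * n'" by (rule dvdE)
  then have n: "n = [:- a, 1:] * n' + [:c:]" by (simp add: algebra_simps)
  have degn: "degree n' \<le> degree d'"
  proof (cases "n' = 0")
    case False
    then have "Suc (degree n') = degree (n - [:c:])"
      unfolding n' by (subst degree_mult_eq) auto
    also have "\<dots> \<le> degree d" using Suc(4) by (metis degree_diff_le degree_pCons_0 le0)
    finally show ?thesis using degd by simp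
  qed simp
  have m: "m = degree d'" using Suc(2) degd by simp
  have Gc: "G \<in> carrier_mat p p" by (rule realizable_carrier[OF Suc(5)])
  have r1: "realizable p ((to_fract n' / to_fract d') \<cdot>\<^sub>m G)"
    by (rule Suc(1)[OF m d'0 degn Suc(5)])
  have r2: "realizable p ((to_fract 1 / to_fract d') \<cdot>\<^sub>m G)"
    by (rule Suc(1)[OF m d'0 _ Suc(5)]) simp
  have "realizable p ((to_fract n' / to_fract d') \<cdot>\<^sub>m G +
      to_fract [:c:] \<cdot>\<^sub>m ((1 / to_fract [:- a, 1:]) \<cdot>\<^sub>m ((to_fract 1 / to_fract d') \<cdot>\<^sub>m G)))"
    by (intro realizable_add realizable_smult_const realizable_divide_linear r1 r2)
  also have "(to_fract n' / to_fract d') \<cdot>\<^sub>m G +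
      to_fract [:c:] \<cdot>\<^sub>m ((1 / to_fract [:- a, 1:]) \<cdot>\<^sub>m ((to_fract 1 / to_fract d') \<cdot>\<^sub>m G)) =
      (to_fract n / to_fract d) \<cdot>\<^sub>m G" (is "?L = _")
  proof -
    have nz: "to_fract d' \<noteq> 0" "to_fract [:- a, 1:] \<noteq> (0 :: ratfun)" using d'0 by auto
    have "to_fract n / to_fract d = to_fract n' / to_fract d' +
        to_fract [:c:] * ((1 / to_fract [:- a, 1:]) * (to_fract 1 / to_fract d'))"
      unfolding n d to_fract_add to_fract_mult using nz by (simp add: field_simps)
    then show ?thesis
      using Gc by (intro eq_matI) (auto simp: algebra_simps)
  qed
  finally show ?case .
qed

theorem proper_imp_realizable:
  assumes G: "G \<in> carrier_mat p p" and proper: "ratmat_proper G"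
  shows "realizable p G"
proof -
  have "realizable p (mat p p (\<lambda>ij. if ij \<in> S then G $$ ij else 0))"
    if "finite S" "S \<subseteq> {..<p} \<times> {..<p}" for S
    using that
  proof (induction S rule: finite_induct)
    case empty
    have "mat p p (\<lambda>ij. if ij \<in> {} then G $$ ij else 0) = const_mat (0\<^sub>m p p)"
      unfolding const_mat_zero by (rule eq_matI) auto
    then show ?case using realizable_const_mat[of "0\<^sub>m p p" p] by simp
  next
    case (insert s S)
    define f where "f = G $$ s"
    define E where "E = (mat p p (\<lambda>ij. if ij = s then 1 else 0) :: complex mat)"
    let ?n = "fst (quot_of_fract f)" and ?d = "snd (quot_of_fract f)"
    have "f \<in> elements_mat G"
      using insert(4) unfolding f_def by (intro elements_matI[OF G, of "fst s" "snd s"]) auto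
    then have "degree ?n \<le> degree ?d"
      using proper unfolding ratmat_proper_def ratfun_proper_def by blast
    then have "realizable p ((to_fract ?n / to_fract ?d) \<cdot>\<^sub>m const_mat E)"
      by (intro realizable_smult_fraction realizable_const_mat) (auto simp: E_def)
    moreover have "to_fract ?n / to_fract ?d = f"
      by (metis Fract_conv_to_fract Fract_quot_of_fract)
    ultimately have "realizable p (f \<cdot>\<^sub>m const_mat E)" by simp
    then have "realizable p (mat p p (\<lambda>ij. if ij \<in> S then G $$ ij else 0) + f \<cdot>\<^sub>m const_mat E)"
      using insert by (intro realizable_add) auto
    also have "mat p p (\<lambda>ij. if ij \<in> S then G $$ ij else 0) + f \<cdot>\<^sub>m const_mat E =
        mat p p (\<lambda>ij. if ij \<in> insert s S then G $$ ij else 0)"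
      by (rule eq_matI) (use insert(2) in \<open>auto simp: E_def const_mat_def f_def\<close>)
    finally show ?case .
  qed
  from this[of "{..<p} \<times> {..<p}"]
  have "realizable p (mat p p (\<lambda>ij. if ij \<in> {..<p} \<times> {..<p} then G $$ ij else 0))" by simp
  also have "mat p p (\<lambda>ij. if ij \<in> {..<p} \<times> {..<p} then G $$ ij else 0) = G"
    by (rule eq_matI) (use G in auto)
  finally show ?thesis .
qed

lemma minimal_realization_exists:
  assumes "realizable p G"
  obtains k A B C D where "is_minimal_realization p k A B C D G"
proof -
  define P where "P k \<longleftrightarrow> (\<exists>A B C D. is_realization p k A B C D G)" for k
  have ex: "\<exists>k. P k" using assms by (auto simp: P_def realizable_def)
  then have "P (LEAST k. P k)" by (rule LeastI_ex)
  then obtain A B C D where "is_realization p (LEAST k. P k) A B C D G" by (auto simp: P_def)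
  moreover have "(LEAST k. P k) \<le> k'" if "is_realization p k' A' B' C' D' G" for k' A' B' C' D'
    by (rule Least_le) (use that in \<open>auto simp: P_def\<close>)
  ultimately show thesis using that unfolding is_minimal_realization_def by blast
qed

lemma realization_update_exists:
  assumes U: "U \<in> carrier_mat (p + \<delta>) (p + \<delta>)" and V: "V \<in> carrier_mat (p + \<delta>) (p + \<delta>)"
  obtains A' B' C' D' where "realization_update p \<delta> U V k A B C D A' B' C' D'"
proof -
  let ?M = "diag_block_mat [U, 1\<^sub>m k]
       * four_block_mat (diag_block_mat [D, 1\<^sub>m \<delta>]) (C @\<^sub>r 0\<^sub>m \<delta> k) (B @\<^sub>c 0\<^sub>m k \<delta>) A
       * diag_block_mat [mat_adjoint V, 1\<^sub>m k]"
  obtain D' C' B' A' where sb: "split_block ?M p p = (D', C', B', A')"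
    by (metis prod_cases4)
  have "dim_row ?M = p + (\<delta> + k)" "dim_col ?M = p + (\<delta> + k)"
    using U V by (simp_all add: Let_def)
  note split_block[OF sb this]
  then show thesis using that unfolding realization_update_def by auto
qed

lemma corresponds_exists:
  assumes "U \<in> carrier_mat (p + \<delta>) (p + \<delta>)" "V \<in> carrier_mat (p + \<delta>) (p + \<delta>)"
    and "G \<in> carrier_mat p p" "ratmat_proper G"
  shows "\<exists>H. corresponds p \<delta> U V G H"
proof -
  obtain k A B C D where min: "is_minimal_realization p k A B C D G"
    using minimal_realization_exists[OF proper_imp_realizable[OF assms(3,4)]] .
  obtain A' B' C' D' where "realization_update p \<delta> U V k A B C D A' B' C' D'"
    using realization_update_exists[OF assms(1,2)] .
  with min show ?thesis unfolding corresponds_def by blast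
qed

section \<open>Values of rational functions\<close>

text \<open>
  Any fraction representing \<open>f\<close> whose denominator does not vanish at \<open>z\<close> may be used here, not only the
  coprime one; this makes the compatibility with sums and products immediate.
\<close>

definition ratfun_has_value :: "ratfun \<Rightarrow> complex \<Rightarrow> complex \<Rightarrow> bool" where
  "ratfun_has_value f z c \<longleftrightarrow>
     (\<exists>n d. f = to_fract n / to_fract d \<and> poly d z \<noteq> 0 \<and> c = poly n z / poly d z)"

lemma ratfun_has_value_eval:
  assumes "ratfun_analytic_at f z"
  shows "ratfun_has_value f z (ratfun_eval f z)"
  unfolding ratfun_has_value_def
  using assms unfolding ratfun_analytic_at_def ratfun_eval_def
  by (metis Fract_conv_to_fract Fract_quot_of_fract)

text \<open>
  The coprime denominator divides every other denominator of \<open>f\<close>, so it cannot vanish where another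
  one does not.
\<close>

lemma ratfun_has_valueD:
  assumes "ratfun_has_value f z c"
  shows "ratfun_analytic_at f z" "ratfun_eval f z = c"
proof -
  obtain n d where f: "f = to_fract n / to_fract d" and d: "poly d z \<noteq> 0" and c: "c = poly n z / poly d z"
    using assms unfolding ratfun_has_value_def by blast
  let ?n = "fst (quot_of_fract f)" and ?d = "snd (quot_of_fract f)"
  have d0: "d \<noteq> 0" using d by auto
  have "to_fract ?n / to_fract ?d = to_fract n / to_fract d"
    using f by (metis Fract_conv_to_fract Fract_quot_of_fract)
  then have "to_fract (?n * d) = to_fract (n * ?d)"
    using d0 by (simp add: frac_eq_eq)
  then have eq: "?n * d = n * ?d" by (simp only: to_fract_eq_iff)
  have "coprime ?d ?n" using coprime_quot_of_fract[of f] by (simp add: coprime_commute)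
  moreover have "?d dvd ?n * d" unfolding eq by simp
  ultimately have "?d dvd d" by (simp add: coprime_dvd_mult_right_iff)
  then have d': "poly ?d z \<noteq> 0" using d by (auto elim!: dvdE)
  then show "ratfun_analytic_at f z" unfolding ratfun_analytic_at_def .
  have "poly ?n z * poly d z = poly n z * poly ?d z"
    using arg_cong[OF eq, of "\<lambda>q. poly q z"] by simp
  then show "ratfun_eval f z = c" unfolding ratfun_eval_def c using d d' by (simp add: frac_eq_eq)
qed

lemma ratfun_has_value_const: "ratfun_has_value (to_fract [:c:]) z c"
  unfolding ratfun_has_value_def by (rule exI[of _ "[:c:]"], rule exI[of _ 1]) simp

lemma ratfun_has_value_ratvar: "ratfun_has_value ratvar z z"
  unfolding ratfun_has_value_def ratvar_def by (rule exI[of _ "[:0, 1:]"], rule exI[of _ 1]) simp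

lemma ratfun_has_value_zero: "ratfun_has_value 0 z 0"
  using ratfun_has_value_const[of 0 z] by simp

lemma ratfun_has_value_add:
  assumes "ratfun_has_value f z c" "ratfun_has_value g z e"
  shows "ratfun_has_value (f + g) z (c + e)"
proof -
  obtain n d where f: "f = to_fract n / to_fract d" "poly d z \<noteq> 0" "c = poly n z / poly d z"
    using assms(1) unfolding ratfun_has_value_def by blast
  obtain n' d' where g: "g = to_fract n' / to_fract d'" "poly d' z \<noteq> 0" "e = poly n' z / poly d' z"
    using assms(2) unfolding ratfun_has_value_def by blast
  have "d \<noteq> 0" "d' \<noteq> 0" using f(2) g(2) by auto
  then have "f + g = to_fract (n * d' + n' * d) / to_fract (d * d')"
    "c + e = poly (n * d' + n' * d) z / poly (d * d') z" "poly (d * d') z \<noteq> 0"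
    using f g by (simp_all add: add_frac_eq)
  then show ?thesis unfolding ratfun_has_value_def by blast
qed

lemma ratfun_has_value_mult:
  assumes "ratfun_has_value f z c" "ratfun_has_value g z e"
  shows "ratfun_has_value (f * g) z (c * e)"
proof -
  obtain n d where f: "f = to_fract n / to_fract d" "poly d z \<noteq> 0" "c = poly n z / poly d z"
    using assms(1) unfolding ratfun_has_value_def by blast
  obtain n' d' where g: "g = to_fract n' / to_fract d'" "poly d' z \<noteq> 0" "e = poly n' z / poly d' z"
    using assms(2) unfolding ratfun_has_value_def by blast
  have "f * g = to_fract (n * n') / to_fract (d * d')"
    "c * e = poly (n * n') z / poly (d * d') z" "poly (d * d') z \<noteq> 0"
    using f g by simp_all
  then show ?thesis unfolding ratfun_has_value_def by blast
qed

lemma ratfun_has_value_uminus: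
  "ratfun_has_value f z c \<Longrightarrow> ratfun_has_value (- f) z (- c)"
  using ratfun_has_value_mult[OF ratfun_has_value_const[of "-1" z], of f c]
  by (metis const_ratfun.hom_uminus const_ratfun.hom_one mult_minus1)

lemma ratfun_has_value_diff:
  "ratfun_has_value f z c \<Longrightarrow> ratfun_has_value g z e \<Longrightarrow> ratfun_has_value (f - g) z (c - e)"
  using ratfun_has_value_add[OF _ ratfun_has_value_uminus, of f z c g e] by simp

lemma ratfun_has_value_sum:
  "(\<And>i. i \<in> I \<Longrightarrow> ratfun_has_value (f i) z (c i)) \<Longrightarrow> ratfun_has_value (sum f I) z (sum c I)"
  by (induction I rule: infinite_finite_induct)
    (auto intro: ratfun_has_value_zero ratfun_has_value_add)

definition ratmat_has_value :: "ratfun mat \<Rightarrow> complex \<Rightarrow> complex mat \<Rightarrow> bool" where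
  "ratmat_has_value F z M \<longleftrightarrow> dim_row F = dim_row M \<and> dim_col F = dim_col M \<and>
     (\<forall>i < dim_row M. \<forall>j < dim_col M. ratfun_has_value (F $$ (i, j)) z (M $$ (i, j)))"

lemma ratmat_has_value_eval:
  "ratmat_analytic_at F z \<Longrightarrow> ratmat_has_value F z (ratmat_eval F z)"
  unfolding ratmat_analytic_at_def ratmat_has_value_def ratmat_eval_def
  by (auto intro!: ratfun_has_value_eval)

lemma ratmat_has_valueD:
  assumes "ratmat_has_value F z M"
  shows "ratmat_eval F z = M"
  by (rule eq_matI) (use assms in \<open>auto simp: ratmat_has_value_def ratmat_eval_def ratfun_has_valueD\<close>)

lemma ratmat_has_value_const: "ratmat_has_value (const_mat A) z A"
  by (auto simp: ratmat_has_value_def const_mat_def ratfun_has_value_const)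

lemma ratmat_has_value_add:
  "ratmat_has_value F z M \<Longrightarrow> ratmat_has_value G z N \<Longrightarrow> dim_row M = dim_row N \<Longrightarrow> dim_col M = dim_col N \<Longrightarrow>
    ratmat_has_value (F + G) z (M + N)"
  by (auto simp: ratmat_has_value_def ratfun_has_value_add)

lemma ratmat_has_value_diff:
  "ratmat_has_value F z M \<Longrightarrow> ratmat_has_value G z N \<Longrightarrow> dim_row M = dim_row N \<Longrightarrow> dim_col M = dim_col N \<Longrightarrow>
    ratmat_has_value (F - G) z (M - N)"
  by (auto simp: ratmat_has_value_def ratfun_has_value_diff)

lemma ratmat_has_value_uminus:
  "ratmat_has_value F z M \<Longrightarrow> ratmat_has_value (- F) z (- M)"
  by (auto simp: ratmat_has_value_def ratfun_has_value_uminus)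

lemma ratmat_has_value_smult_ratvar:
  "ratmat_has_value F z M \<Longrightarrow> ratmat_has_value (ratvar \<cdot>\<^sub>m F) z (z \<cdot>\<^sub>m M)"
  by (auto simp: ratmat_has_value_def ratfun_has_value_mult ratfun_has_value_ratvar)

lemma ratmat_has_value_mult:
  assumes "ratmat_has_value F z M" "ratmat_has_value G z N" "dim_col M = dim_row N"
  shows "ratmat_has_value (F * G) z (M * N)"
  using assms
  by (auto simp: ratmat_has_value_def scalar_prod_def intro!: ratfun_has_value_sum ratfun_has_value_mult)

lemma ratmat_has_value_four_block_mat:
  assumes "ratmat_has_value F1 z M1" "ratmat_has_value F2 z M2" "ratmat_has_value F3 z M3" "ratmat_has_value F4 z M4"
    and "M1 \<in> carrier_mat n1 m1" "M2 \<in> carrier_mat n1 m2" "M3 \<in> carrier_mat n2 m1" "M4 \<in> carrier_mat n2 m2"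
  shows "ratmat_has_value (four_block_mat F1 F2 F3 F4) z (four_block_mat M1 M2 M3 M4)"
  using assms by (auto simp: ratmat_has_value_def)

lemma finite_poles: "finite {z. \<not> ratmat_analytic_at F z}"
proof -
  have "{z. \<not> ratmat_analytic_at F z} \<subseteq>
    (\<Union>i \<in> {..<dim_row F}. \<Union>j \<in> {..<dim_col F}. {z. poly (snd (quot_of_fract (F $$ (i, j)))) z = 0})"
    by (auto simp: ratmat_analytic_at_def ratfun_analytic_at_def dest!: elements_matD)
  then show ?thesis by (rule finite_subset) (auto intro!: poly_roots_finite)
qed

lemma isCont_ratfun_eval:
  assumes "ratfun_analytic_at f z"
  shows "isCont (ratfun_eval f) z"
  using assms unfolding ratfun_analytic_at_def ratfun_eval_def[abs_def]
  by (intro continuous_intros) auto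

section \<open>The lossless identity at a regular point\<close>

text \<open>
  A unitary factor on the right preserves the Gram matrix of the rows of \<open>(X, Y)\<close>.
\<close>

lemma unitary_gram:
  fixes M :: "complex mat"
  assumes c: "M \<in> carrier_mat p p" "a \<in> carrier_mat p \<delta>" "b \<in> carrier_mat \<delta> p" "K \<in> carrier_mat \<delta> \<delta>"
    and X: "X \<in> carrier_mat n p" and Y: "Y \<in> carrier_mat n \<delta>"
    and U: "unitary_mat (p + \<delta>) (four_block_mat M a b K)"
  defines "P \<equiv> X * M + Y * b" and "S \<equiv> X * a + Y * K"
  shows "P * mat_adjoint P + S * mat_adjoint S = X * mat_adjoint X + Y * mat_adjoint Y"
proof -
  let ?U = "four_block_mat M a b K" and ?XY = "X @\<^sub>c Y"
  have Uc: "?U \<in> carrier_mat (p + \<delta>) (p + \<delta>)" and UU: "?U * mat_adjoint ?U = 1\<^sub>m (p + \<delta>)"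
    using U by (auto simp: unitary_mat_def)
  have P: "P \<in> carrier_mat n p" and S: "S \<in> carrier_mat n \<delta>"
    using mult_carrier_mat[OF Y c(3)] mult_carrier_mat[OF Y c(4)] by (auto simp: P_def S_def)
  have XY: "?XY \<in> carrier_mat n (p + \<delta>)" using X Y by simp
  have prod: "?XY * ?U = P @\<^sub>c S"
    unfolding P_def S_def by (rule append_cols_mult_four_block_mat[OF X Y c])
  have gram: "(A @\<^sub>c B) * mat_adjoint (A @\<^sub>c B) = A * mat_adjoint A + B * mat_adjoint B"
    if "A \<in> carrier_mat n p" "B \<in> carrier_mat n \<delta>" for A B :: "complex mat"
    unfolding mat_adjoint_append_cols[OF that]
    by (rule append_cols_mult_append_rows[OF that]) (use that in auto)
  have "P * mat_adjoint P + S * mat_adjoint S = (?XY * ?U) * mat_adjoint (?XY * ?U)"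
    unfolding prod gram[OF P S] ..
  also have "mat_adjoint (?XY * ?U) = mat_adjoint ?U * mat_adjoint ?XY"
    by (rule mat_adjoint_mult[OF XY Uc])
  also have "?XY * ?U * (mat_adjoint ?U * mat_adjoint ?XY) = ?XY * (?U * (mat_adjoint ?U * mat_adjoint ?XY))"
    by (rule assoc_mult_mat[OF XY Uc mult_carrier_mat[OF mat_adjoint_carrier(1)[OF Uc] mat_adjoint_carrier(1)[OF XY]]])
  also have "?U * (mat_adjoint ?U * mat_adjoint ?XY) = ?U * mat_adjoint ?U * mat_adjoint ?XY"
    by (rule assoc_mult_mat[symmetric, OF Uc mat_adjoint_carrier(1)[OF Uc] mat_adjoint_carrier(1)[OF XY]])
  also have "\<dots> = mat_adjoint ?XY"
    unfolding UU by (rule left_mult_one_mat[OF mat_adjoint_carrier(1)[OF XY]])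
  also have "?XY * mat_adjoint ?XY = X * mat_adjoint X + Y * mat_adjoint Y"
    by (rule gram[OF X Y])
  finally show ?thesis .
qed

text \<open>
  Write \<open>T = (P1, P2)\<close> in block columns, \<open>E1\<close> and \<open>E2\<close> for the block columns of the identity, and
  \<open>Q = \<alpha> R\<close>. Then \<open>(E1, Q) U = (P1, S)\<close>, and the equation satisfied by the resolvent \<open>R\<close> is exactly what
  makes \<open>(E2, - z Q) V = (P2, - S)\<close> with the same \<open>S\<close> up to sign. Comparing Gram matrices,
  \<open>P1 P1\<^sup>* + S S\<^sup>* = E1 E1\<^sup>* + Q Q\<^sup>*\<close> and \<open>P2 P2\<^sup>* + S S\<^sup>* = E2 E2\<^sup>* + |z|\<^sup>2 Q Q\<^sup>*\<close>; in the difference \<open>S\<close> cancels,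
  leaving \<open>J - T J T\<^sup>* = (|z|\<^sup>2 - 1) Q Q\<^sup>*\<close>.
\<close>

lemma lossless_identity:
  fixes Mu Mv au av bu bv Ku Kv R :: "complex mat" and z :: complex
  assumes c: "Mu \<in> carrier_mat p p" "au \<in> carrier_mat p \<delta>" "bu \<in> carrier_mat \<delta> p" "Ku \<in> carrier_mat \<delta> \<delta>"
    and d: "Mv \<in> carrier_mat p p" "av \<in> carrier_mat p \<delta>" "bv \<in> carrier_mat \<delta> p" "Kv \<in> carrier_mat \<delta> \<delta>"
    and R: "R \<in> carrier_mat \<delta> \<delta>"
    and U: "unitary_mat (p + \<delta>) (four_block_mat Mu au bu Ku)"
    and V: "unitary_mat (p + \<delta>) (four_block_mat Mv av bv Kv)"
    and inv: "R * (z \<cdot>\<^sub>m Kv - Ku) = 1\<^sub>m \<delta>"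
  defines "T \<equiv> four_block_mat (Mu + au * R * bu) (- (z \<cdot>\<^sub>m (au * R * bv)))
      (av * R * bu) (Mv - z \<cdot>\<^sub>m (av * R * bv))"
    and "Q \<equiv> (au @\<^sub>r av) * R"
  shows "J_mat p - T * J_mat p * mat_adjoint T =
    complex_of_real ((cmod z)\<^sup>2 - 1) \<cdot>\<^sub>m (Q * mat_adjoint Q)"
proof -
  let ?n = "p + p"
  define E1 E2 where "E1 = (1\<^sub>m p @\<^sub>r 0\<^sub>m p p :: complex mat)" and "E2 = (0\<^sub>m p p @\<^sub>r 1\<^sub>m p :: complex mat)"
  define Q2 where "Q2 = (- z) \<cdot>\<^sub>m Q"
  have E1: "E1 \<in> carrier_mat ?n p" and E2: "E2 \<in> carrier_mat ?n p"
    by (auto simp: E1_def E2_def)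
  have auR: "au * R \<in> carrier_mat p \<delta>" and avR: "av * R \<in> carrier_mat p \<delta>"
    using c d R by auto
  have Qr: "Q = (au * R) @\<^sub>r (av * R)"
    unfolding Q_def by (rule append_rows_mult[OF c(2) d(2) R])
  have Q: "Q \<in> carrier_mat ?n \<delta>" unfolding Qr using auR avR by auto
  have Q2: "Q2 \<in> carrier_mat ?n \<delta>" unfolding Q2_def using Q by simp
  define P1 P2 S1 S2 where "P1 = E1 * Mu + Q * bu" and "P2 = E2 * Mv + Q2 * bv"
    and "S1 = E1 * au + Q * Ku" and "S2 = E2 * av + Q2 * Kv"
  have P1: "P1 \<in> carrier_mat ?n p" and P2: "P2 \<in> carrier_mat ?n p"
    and S1: "S1 \<in> carrier_mat ?n \<delta>" and S2: "S2 \<in> carrier_mat ?n \<delta>"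
    unfolding P1_def P2_def S1_def S2_def
    using mult_carrier_mat[OF Q c(3)] mult_carrier_mat[OF Q2 d(3)] mult_carrier_mat[OF Q c(4)]
      mult_carrier_mat[OF Q2 d(4)] by auto
  have E1m: "E1 * X = X @\<^sub>r 0\<^sub>m p m" and E2m: "E2 * X = 0\<^sub>m p m @\<^sub>r X" if "X \<in> carrier_mat p m" for X m
    using append_rows_mult[OF one_carrier_mat[of p] zero_carrier_mat[of p p] that]
      append_rows_mult[OF zero_carrier_mat[of p p] one_carrier_mat[of p] that] that
    by (simp_all add: E1_def E2_def left_mult_one_mat[OF that])
  have Qm: "Q * X = (au * R * X) @\<^sub>r (av * R * X)" if "X \<in> carrier_mat \<delta> m" for X m
    unfolding Qr by (rule append_rows_mult[OF auR avR that])
  have carr: "au * R * X \<in> carrier_mat p m" "av * R * X \<in> carrier_mat p m" if "X \<in> carrier_mat \<delta> m" for X m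
    using mult_carrier_mat[OF auR that] mult_carrier_mat[OF avR that] by auto
  have Q2m: "Q2 * X = (- z) \<cdot>\<^sub>m (Q * X)" if "X \<in> carrier_mat \<delta> m" for X m
    unfolding Q2_def by (rule mult_smult_assoc_mat[OF Q that])
  \<comment> \<open>\<open>S1 = - S2\<close> is where the resolvent equation enters.\<close>
  have "S1 = - S2"
  proof -
    have zK: "z \<cdot>\<^sub>m Kv \<in> carrier_mat \<delta> \<delta>" using d by simp
    have pc: "z \<cdot>\<^sub>m Kv - Ku \<in> carrier_mat \<delta> \<delta>" using c d by auto
    have ac: "au @\<^sub>r av \<in> carrier_mat ?n \<delta>" using c d by simp
    have "z \<cdot>\<^sub>m (Q * Kv) - Q * Ku = Q * (z \<cdot>\<^sub>m Kv - Ku)"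
      using mult_minus_distrib_mat[OF Q zK c(4)] mult_smult_distrib[OF Q d(4), of z] by simp
    also have "\<dots> = (au @\<^sub>r av) * (R * (z \<cdot>\<^sub>m Kv - Ku))"
      unfolding Q_def by (rule assoc_mult_mat[OF ac R pc])
    also have "\<dots> = au @\<^sub>r av" unfolding inv by (rule right_mult_one_mat[OF ac])
    finally have e: "z \<cdot>\<^sub>m (Q * Kv) - Q * Ku = au @\<^sub>r av" .
    have ee: "E1 * au + E2 * av = au @\<^sub>r av"
      unfolding E1m[OF c(2)] E2m[OF d(2)] using c d by (intro eq_matI) (auto simp: append_rows_def)
    have ix: "(z \<cdot>\<^sub>m (Q * Kv) - Q * Ku) $$ (i, j) = (E1 * au + E2 * av) $$ (i, j)" for i j
      using e ee by simp
    have QK: "Q * Kv \<in> carrier_mat ?n \<delta>" "Q * Ku \<in> carrier_mat ?n \<delta>" "E1 * au \<in> carrier_mat ?n \<delta>"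
      "E2 * av \<in> carrier_mat ?n \<delta>"
      using Q c d E1 E2 by auto
    note QKd = QK[THEN carrier_matD(1)] QK[THEN carrier_matD(2)]
    show ?thesis
    proof (rule eq_matI)
      fix i j assume "i < dim_row (- S2)" "j < dim_col (- S2)"
      then have ij: "i < ?n" "j < \<delta>" using S2 by auto
      have "z * (Q * Kv) $$ (i, j) - (Q * Ku) $$ (i, j) = (E1 * au) $$ (i, j) + (E2 * av) $$ (i, j)"
        using ix[of i j] ij QKd by (simp del: index_mult_mat)
      then show "S1 $$ (i, j) = (- S2) $$ (i, j)"
        unfolding S1_def S2_def Q2m[OF d(4)] using ij QKd by (simp del: index_mult_mat add: algebra_simps)
    qed (use S1 S2 in auto)
  qed
  then have SS: "S1 * mat_adjoint S1 = S2 * mat_adjoint S2"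
    using S2 by (auto intro!: eq_matI simp: scalar_prod_def sum_negf)
  have g1: "P1 * mat_adjoint P1 + S1 * mat_adjoint S1 = E1 * mat_adjoint E1 + Q * mat_adjoint Q"
    unfolding P1_def S1_def by (rule unitary_gram[OF c E1 Q U])
  have g2: "P2 * mat_adjoint P2 + S2 * mat_adjoint S2 = E2 * mat_adjoint E2 + Q2 * mat_adjoint Q2"
    unfolding P2_def S2_def by (rule unitary_gram[OF d E2 Q2 V])
  have QQ: "Q2 * mat_adjoint Q2 = complex_of_real ((cmod z)\<^sup>2) \<cdot>\<^sub>m (Q * mat_adjoint Q)"
  proof -
    have "Q2 * mat_adjoint Q2 = (- z * cnj (- z)) \<cdot>\<^sub>m (Q * mat_adjoint Q)"
      unfolding Q2_def mat_adjoint_smult using Q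
      by (intro eq_matI) (auto simp: scalar_prod_def sum_distrib_left ac_simps)
    then show ?thesis by (simp only: complex_norm_square[symmetric] norm_minus_cancel)
  qed
  have T: "T = P1 @\<^sub>c P2"
  proof -
    have PP1: "P1 = (Mu + au * R * bu) @\<^sub>r (av * R * bu)"
      unfolding P1_def E1m[OF c(1)] Qm[OF c(3)] using c carr[OF c(3)]
      by (subst append_rows_add) (auto simp: left_add_zero_mat[OF carr(2)[OF c(3)]])
    have PP2: "P2 = (- (z \<cdot>\<^sub>m (au * R * bv))) @\<^sub>r (Mv - z \<cdot>\<^sub>m (av * R * bv))"
      unfolding P2_def E2m[OF d(1)] Q2m[OF d(3)] Qm[OF d(3)] using d carr[OF d(3)]
      by (intro eq_matI) (auto simp: append_rows_def simp del: index_mult_mat)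
    show ?thesis
      unfolding T_def PP1 PP2
      by (rule append_cols_append_rows[symmetric, OF add_carrier_mat[OF carr(1)[OF c(3)]]
            uminus_carrier_mat[OF smult_carrier_mat[OF carr(1)[OF d(3)]]] carr(2)[OF c(3)]
            minus_carrier_mat[OF smult_carrier_mat[OF carr(2)[OF d(3)]]]])
  qed
  have J: "J_mat p = four_block_mat (1\<^sub>m p) (0\<^sub>m p p) (0\<^sub>m p p) (- 1\<^sub>m p)"
    unfolding J_mat_def by (rule diag_block_mat_pair) auto
  have "T * J_mat p = (P1 * 1\<^sub>m p + P2 * 0\<^sub>m p p) @\<^sub>c (P1 * 0\<^sub>m p p + P2 * (- 1\<^sub>m p))"
    unfolding T J by (rule append_cols_mult_four_block_mat[OF P1 P2]) auto
  also have "P1 * 1\<^sub>m p + P2 * 0\<^sub>m p p = P1"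
    using P1 P2 by (intro eq_matI) (auto simp: right_mult_one_mat[OF P1] right_mult_zero_mat[OF P2])
  also have "P1 * 0\<^sub>m p p + P2 * (- 1\<^sub>m p) = - P2"
    using P1 P2 by (intro eq_matI) (auto simp: right_mult_one_mat[OF P2] right_mult_zero_mat[OF P1])
  finally have TJ: "T * J_mat p = P1 @\<^sub>c - P2" .
  have mP2: "- P2 \<in> carrier_mat ?n p" using P2 by simp
  have TJT: "T * J_mat p * mat_adjoint T = P1 * mat_adjoint P1 + - P2 * mat_adjoint P2"
    unfolding TJ unfolding T mat_adjoint_append_cols[OF P1 P2]
    by (rule append_cols_mult_append_rows[OF P1 mP2]) (use P1 P2 in auto)
  have JE: "J_mat p = E1 * mat_adjoint E1 - E2 * mat_adjoint E2"
  proof -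
    have a1: "mat_adjoint E1 = 1\<^sub>m p @\<^sub>c 0\<^sub>m p p"
      unfolding E1_def by (rule eq_matI) (auto simp: append_rows_def append_cols_def)
    have a2: "mat_adjoint E2 = 0\<^sub>m p p @\<^sub>c 1\<^sub>m p"
      unfolding E2_def by (rule eq_matI) (auto simp: append_rows_def append_cols_def)
    have m1: "E1 * mat_adjoint E1 = (1\<^sub>m p @\<^sub>c 0\<^sub>m p p) @\<^sub>r 0\<^sub>m p ?n"
      unfolding a1 by (rule E1m) auto
    have m2: "E2 * mat_adjoint E2 = 0\<^sub>m p ?n @\<^sub>r (0\<^sub>m p p @\<^sub>c 1\<^sub>m p)"
      unfolding a2 by (rule E2m) auto
    show ?thesis
      unfolding J m1 m2 by (rule eq_matI) (auto simp: append_rows_def append_cols_def)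
  qed
  have Gc: "P1 * mat_adjoint P1 \<in> carrier_mat ?n ?n" "P2 * mat_adjoint P2 \<in> carrier_mat ?n ?n"
    "S2 * mat_adjoint S2 \<in> carrier_mat ?n ?n" "Q * mat_adjoint Q \<in> carrier_mat ?n ?n"
    "E1 * mat_adjoint E1 \<in> carrier_mat ?n ?n" "E2 * mat_adjoint E2 \<in> carrier_mat ?n ?n"
    using P1 P2 S2 Q E1 E2 by auto
  note Gd = Gc[THEN carrier_matD(1)] Gc[THEN carrier_matD(2)]
  have "- P2 * mat_adjoint P2 = - (P2 * mat_adjoint P2)"
    using P2 by (intro uminus_mult_left_mat) auto
  note TJT' = TJT[unfolded this]
  note g1' = g1[unfolded SS] and g2' = g2[unfolded QQ]
  have arith: "e - f - (a - b) = (w - 1) * q" if "a + s = e + q" "b + s = f + w * q"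
    for a b e f q s w :: complex
  proof -
    have ab: "a = e + q - s" "b = f + w * q - s" using that by (simp_all add: eq_diff_eq)
    show ?thesis unfolding ab by (simp add: algebra_simps)
  qed
  show ?thesis
  proof (rule eq_matI)
    fix i j
    assume "i < dim_row (complex_of_real ((cmod z)\<^sup>2 - 1) \<cdot>\<^sub>m (Q * mat_adjoint Q))"
      "j < dim_col (complex_of_real ((cmod z)\<^sup>2 - 1) \<cdot>\<^sub>m (Q * mat_adjoint Q))"
    then have ij: "i < ?n" "j < ?n" using Q by auto
    have 1: "(P1 * mat_adjoint P1) $$ (i, j) + (S2 * mat_adjoint S2) $$ (i, j) =
        (E1 * mat_adjoint E1) $$ (i, j) + (Q * mat_adjoint Q) $$ (i, j)"
      using arg_cong[OF g1', of "\<lambda>M. M $$ (i, j)"] Gd ij by (simp del: index_mult_mat)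
    have 2: "(P2 * mat_adjoint P2) $$ (i, j) + (S2 * mat_adjoint S2) $$ (i, j) =
        (E2 * mat_adjoint E2) $$ (i, j) + complex_of_real ((cmod z)\<^sup>2) * (Q * mat_adjoint Q) $$ (i, j)"
      using arg_cong[OF g2', of "\<lambda>M. M $$ (i, j)"] Gd ij by (simp del: index_mult_mat)
    have "(J_mat p - T * J_mat p * mat_adjoint T) $$ (i, j) =
       (E1 * mat_adjoint E1) $$ (i, j) - (E2 * mat_adjoint E2) $$ (i, j) -
       ((P1 * mat_adjoint P1) $$ (i, j) - (P2 * mat_adjoint P2) $$ (i, j))"
      unfolding TJT' unfolding JE using Gd ij by (simp del: index_mult_mat)
    also have "\<dots> = (complex_of_real ((cmod z)\<^sup>2) - 1) * (Q * mat_adjoint Q) $$ (i, j)"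
      using 1 2 by (rule arith)
    finally show "(J_mat p - T * J_mat p * mat_adjoint T) $$ (i, j) =
      (complex_of_real ((cmod z)\<^sup>2 - 1) \<cdot>\<^sub>m (Q * mat_adjoint Q)) $$ (i, j)"
      using Gd ij by (simp del: index_mult_mat)
  qed (use Q Gc in \<open>auto simp: TJT'\<close>)
qed

lemma gram_quadratic_form_nonneg:
  fixes Q :: "complex mat"
  assumes Q: "Q \<in> carrier_mat n m" and v: "v \<in> carrier_vec n" and c: "0 \<le> (c :: real)"
  shows "0 \<le> ((complex_of_real c \<cdot>\<^sub>m (Q * mat_adjoint Q)) *\<^sub>v v) \<bullet>c v"
proof -
  define w where "w = mat_adjoint Q *\<^sub>v v"
  have w: "w \<in> carrier_vec m" unfolding w_def
    by (rule mult_mat_vec_carrier[OF mat_adjoint_carrier(1)[OF Q] v])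
  have swap: "(Q *\<^sub>v w) \<bullet>c v = w \<bullet>c w"
  proof -
    have "(Q *\<^sub>v w) \<bullet>c v = (\<Sum>i<n. \<Sum>k<m. Q $$ (i, k) * w $ k * cnj (v $ i))"
      using Q v w by (simp add: scalar_prod_def sum_distrib_right atLeast0LessThan)
    also have "\<dots> = (\<Sum>k<m. \<Sum>i<n. Q $$ (i, k) * w $ k * cnj (v $ i))"
      by (rule sum.swap)
    also have "\<dots> = (\<Sum>k<m. w $ k * cnj (\<Sum>i<n. cnj (Q $$ (i, k)) * v $ i))"
      by (simp add: sum_distrib_left ac_simps)
    also have "\<dots> = (\<Sum>k<m. w $ k * cnj (w $ k))"
      using Q v by (intro sum.cong refl) (simp add: w_def scalar_prod_def atLeast0LessThan)
    also have "\<dots> = w \<bullet>c w" using w by (simp add: scalar_prod_def atLeast0LessThan)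
    finally show ?thesis .
  qed
  have "(complex_of_real c \<cdot>\<^sub>m (Q * mat_adjoint Q)) *\<^sub>v v = complex_of_real c \<cdot>\<^sub>v (Q *\<^sub>v w)"
  proof -
    have "(Q * mat_adjoint Q) *\<^sub>v v = Q *\<^sub>v w"
      unfolding w_def by (rule assoc_mult_mat_vec[OF Q mat_adjoint_carrier(1)[OF Q] v])
    moreover have "Q * mat_adjoint Q \<in> carrier_mat n n" using Q by auto
    then have "(complex_of_real c \<cdot>\<^sub>m (Q * mat_adjoint Q)) *\<^sub>v v = complex_of_real c \<cdot>\<^sub>v ((Q * mat_adjoint Q) *\<^sub>v v)"
      using v by (intro eq_vecI) auto
    ultimately show ?thesis by simp
  qed
  then have "((complex_of_real c \<cdot>\<^sub>m (Q * mat_adjoint Q)) *\<^sub>v v) \<bullet>c v = complex_of_real c * (w \<bullet>c w)"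
    using Q v w swap by (simp add: smult_scalar_prod_distrib[of _ n])
  moreover have "0 \<le> w \<bullet>c w" by (rule conjugate_square_ge_0_vec)
  moreover have "0 \<le> complex_of_real c" using c by (simp add: less_eq_complex_def)
  ultimately show ?thesis by simp
qed

section \<open>Losslessness at every point of analyticity\<close>

text \<open>
  The function may be analytic at a point where the pencil is singular, so that the identity above is
  not available there. Such points are reached by rotation: the points \<open>z e\<^sup>i\<^sup>t\<close> with small \<open>t > 0\<close> have the same
  modulus as \<open>z\<close>, which treats the circle and its exterior alike, and they avoid any given finite set.
\<close>

lemma eventually_rotation_avoids_finite:
  fixes z :: complex
  assumes "finite F" "z \<noteq> 0"
  shows "eventually (\<lambda>n. z * cis (1 / (real n + 1)) \<notin> F) sequentially"
proof -
  have "inj (\<lambda>n. z * cis (1 / (real n + 1)))"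
  proof (rule injI)
    fix n m :: nat
    assume "z * cis (1 / (real n + 1)) = z * cis (1 / (real m + 1))"
    \<comment> \<open>The angles lie in \<open>[0, \<pi>]\<close>, where already the cosine is injective.\<close>
    then have "cis (1 / (real n + 1)) = cis (1 / (real m + 1))" using \<open>z \<noteq> 0\<close> by simp
    from arg_cong[OF this, of Re] have "cos (1 / (real n + 1)) = cos (1 / (real m + 1))" by simp
    moreover have "0 \<le> 1 / (real k + 1) \<and> 1 / (real k + 1) \<le> pi" for k
    proof -
      have "1 / (real k + 1) \<le> 1" by simp
      with pi_ge_two have "1 / (real k + 1) \<le> pi" by linarith
      then show ?thesis by simp
    qed
    ultimately have "1 / (real n + 1) = 1 / (real m + 1)" using cos_inj_pi by blast
    then show "n = m" by simp
  qed
  then have "finite {n. z * cis (1 / (real n + 1)) \<in> F}"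
    using finite_vimageI[OF \<open>finite F\<close>] by (simp add: vimage_def)
  then show ?thesis
    by (simp add: cofinite_eq_sequentially[symmetric] eventually_cofinite)
qed

lemma rotation_tendsto: "(\<lambda>n. z * cis (1 / (real n + 1))) \<longlonglongrightarrow> z"
proof -
  have "(\<lambda>n. 1 / (real n + 1)) \<longlonglongrightarrow> 0"
    using LIMSEQ_inverse_real_of_nat by (simp add: inverse_eq_divide add.commute)
  then have "(\<lambda>n. z * cis (1 / (real n + 1))) \<longlonglongrightarrow> z * cis 0"
    by (intro tendsto_intros)
  then show ?thesis by simp
qed

lemma defect_entry_tendsto:
  fixes T :: "nat \<Rightarrow> complex mat"
  assumes T: "\<And>n. T n \<in> carrier_mat m m" and L: "L \<in> carrier_mat m m" and J: "J \<in> carrier_mat m m"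
    and lim: "\<And>i j. i < m \<Longrightarrow> j < m \<Longrightarrow> (\<lambda>n. T n $$ (i, j)) \<longlonglongrightarrow> L $$ (i, j)"
    and ij: "i < m" "j < m"
  shows "(\<lambda>n. (J - T n * J * mat_adjoint (T n)) $$ (i, j)) \<longlonglongrightarrow> (J - L * J * mat_adjoint L) $$ (i, j)"
proof -
  have e: "(J - X * J * mat_adjoint X) $$ (i, j) =
      J $$ (i, j) - (\<Sum>k<m. (\<Sum>l<m. X $$ (i, l) * J $$ (l, k)) * cnj (X $$ (j, k)))"
    if "X \<in> carrier_mat m m" for X
    using that J ij by (simp add: scalar_prod_def atLeast0LessThan)
  show ?thesis
    unfolding e[OF T] e[OF L]
    by (intro tendsto_intros tendsto_sum lim) (use ij in auto)
qed

lemma quadratic_form_tendsto: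
  fixes D :: "nat \<Rightarrow> complex mat"
  assumes D: "\<And>n. D n \<in> carrier_mat m m" and L: "L \<in> carrier_mat m m" and v: "v \<in> carrier_vec m"
    and lim: "\<And>i j. i < m \<Longrightarrow> j < m \<Longrightarrow> (\<lambda>n. D n $$ (i, j)) \<longlonglongrightarrow> L $$ (i, j)"
  shows "(\<lambda>n. (D n *\<^sub>v v) \<bullet>c v) \<longlonglongrightarrow> (L *\<^sub>v v) \<bullet>c v"
proof -
  have e: "(X *\<^sub>v v) \<bullet>c v = (\<Sum>i<m. (\<Sum>j<m. X $$ (i, j) * v $ j) * cnj (v $ i))"
    if "X \<in> carrier_mat m m" for X
    using that v by (simp add: scalar_prod_def atLeast0LessThan)
  show ?thesis
    unfolding e[OF D] e[OF L] by (intro tendsto_intros tendsto_sum lim) auto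
qed

lemma complex_nonneg_limit:
  fixes x :: "nat \<Rightarrow> complex"
  assumes "x \<longlonglongrightarrow> l" "eventually (\<lambda>n. 0 \<le> x n) sequentially"
  shows "0 \<le> l"
proof -
  have "0 \<le> Re l"
    by (rule tendsto_lowerbound[OF tendsto_Re[OF assms(1)]])
      (use assms(2) in \<open>auto simp: less_eq_complex_def elim: eventually_mono\<close>)
  moreover have "(\<lambda>n. Im (x n)) \<longlonglongrightarrow> 0"
    by (rule tendsto_eventually) (use assms(2) in \<open>auto simp: less_eq_complex_def elim: eventually_mono\<close>)
  then have "Im l = 0" using tendsto_Im[OF assms(1)] LIMSEQ_unique by blast
  ultimately show ?thesis by (simp add: less_eq_complex_def)
qed

text \<open>
  Both parts of losslessness are closed conditions, so they survive the limit along rotated points.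
\<close>

lemma J_losslessI_off_finite:
  assumes Theta: "\<Theta> \<in> carrier_mat (2 * p) (2 * p)" and fin: "finite F"
    and Q: "\<And>z. z \<notin> F \<Longrightarrow> \<exists>Q m. Q \<in> carrier_mat (2 * p) m \<and>
      J_mat p - ratmat_eval \<Theta> z * J_mat p * mat_adjoint (ratmat_eval \<Theta> z) =
      complex_of_real ((cmod z)\<^sup>2 - 1) \<cdot>\<^sub>m (Q * mat_adjoint Q)"
  shows "J_lossless p \<Theta>"
proof -
  let ?m = "2 * p" and ?J = "J_mat p" and ?T = "\<lambda>z. ratmat_eval \<Theta> z"
  have J: "?J \<in> carrier_mat ?m ?m" unfolding J_mat_def carrier_mat_def by (simp add: Let_def)
  have T: "?T z \<in> carrier_mat ?m ?m" for z using Theta by (auto simp: ratmat_eval_def)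
  let ?D = "\<lambda>z. ?J - ?T z * ?J * mat_adjoint (?T z)"
  have TJT: "?T z * ?J * mat_adjoint (?T z) \<in> carrier_mat ?m ?m" for z
    by (intro mult_carrier_mat[of _ ?m ?m]) (use T J in auto)
  then have D: "?D z \<in> carrier_mat ?m ?m" for z by (rule minus_carrier_mat)
  have main: "(cmod z > 1 \<longrightarrow> loewner_le ?m (?T z * ?J * mat_adjoint (?T z)) ?J) \<and>
      (cmod z = 1 \<longrightarrow> ?T z * ?J * mat_adjoint (?T z) = ?J)"
    if an: "ratmat_analytic_at \<Theta> z" and z: "cmod z \<ge> 1" for z
  proof -
    define w where "w n = z * cis (1 / (real n + 1))" for n :: nat
    have cw: "cmod (w n) = cmod z" for n by (simp add: w_def norm_mult)
    have wz: "w \<longlonglongrightarrow> z" using rotation_tendsto[of z] by (simp add: w_def[abs_def])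
    have good: "eventually (\<lambda>n. w n \<notin> F) sequentially"
      unfolding w_def by (rule eventually_rotation_avoids_finite[OF fin]) (use z in auto)
    have Tlim: "(\<lambda>n. ?T (w n) $$ (i, j)) \<longlonglongrightarrow> ?T z $$ (i, j)" if "i < ?m" "j < ?m" for i j
    proof -
      have "\<Theta> $$ (i, j) \<in> elements_mat \<Theta>" using elements_matI[OF Theta that] by simp
      then have "isCont (ratfun_eval (\<Theta> $$ (i, j))) z"
        using an by (intro isCont_ratfun_eval) (auto simp: ratmat_analytic_at_def)
      then have "(\<lambda>n. ratfun_eval (\<Theta> $$ (i, j)) (w n)) \<longlonglongrightarrow> ratfun_eval (\<Theta> $$ (i, j)) z"
        using wz by (rule isCont_tendsto_compose)
      then show ?thesis using Theta that by (simp add: ratmat_eval_def)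
    qed
    have Dlim: "(\<lambda>n. ?D (w n) $$ (i, j)) \<longlonglongrightarrow> ?D z $$ (i, j)" if "i < ?m" "j < ?m" for i j
      by (rule defect_entry_tendsto[OF T T J Tlim that])
    show ?thesis
    proof (intro conjI impI)
      assume "cmod z > 1"
      then have "0 \<le> (cmod z)\<^sup>2 - 1" by simp
      have "0 \<le> (?D z *\<^sub>v v) \<bullet>c v" if v: "v \<in> carrier_vec ?m" for v
      proof (rule complex_nonneg_limit)
        show "(\<lambda>n. (?D (w n) *\<^sub>v v) \<bullet>c v) \<longlonglongrightarrow> (?D z *\<^sub>v v) \<bullet>c v"
          by (rule quadratic_form_tendsto[OF D D v Dlim])
        show "eventually (\<lambda>n. 0 \<le> (?D (w n) *\<^sub>v v) \<bullet>c v) sequentially"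
          using good
        proof (rule eventually_mono)
          fix n assume "w n \<notin> F"
          then obtain Q k where Qc: "Q \<in> carrier_mat ?m k"
            and eq: "?D (w n) = complex_of_real ((cmod (w n))\<^sup>2 - 1) \<cdot>\<^sub>m (Q * mat_adjoint Q)"
            using Q by blast
          show "0 \<le> (?D (w n) *\<^sub>v v) \<bullet>c v"
            unfolding eq cw by (rule gram_quadratic_form_nonneg[OF Qc v]) fact
        qed
      qed
      then show "loewner_le ?m (?T z * ?J * mat_adjoint (?T z)) ?J"
        unfolding loewner_le_def using TJT J by blast
    next
      assume z1: "cmod z = 1"
      have "?D z $$ (i, j) = 0" if ij: "i < ?m" "j < ?m" for i j
      proof (rule LIMSEQ_unique[OF Dlim[OF ij]])
        show "(\<lambda>n. ?D (w n) $$ (i, j)) \<longlonglongrightarrow> 0"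
        proof (rule tendsto_eventually, rule eventually_mono[OF good])
          fix n assume "w n \<notin> F"
          then obtain Q k where Qc: "Q \<in> carrier_mat ?m k"
            and eq: "?D (w n) = complex_of_real ((cmod (w n))\<^sup>2 - 1) \<cdot>\<^sub>m (Q * mat_adjoint Q)"
            using Q by blast
          show "?D (w n) $$ (i, j) = 0"
            unfolding eq cw z1 using Qc ij by simp
        qed
      qed
      then show "?T z * ?J * mat_adjoint (?T z) = ?J"
        using TJT[of z] J by (intro eq_matI) (auto simp del: index_mult_mat)
    qed
  qed
  then show ?thesis using Theta unfolding J_lossless_def Let_def by auto
qed

section \<open>The coefficient function of a pair of unitary matrices\<close>

locale unitary_pair =
  fixes p \<delta> :: nat
    and Mu \<alpha>u \<beta>u Ku Mv \<alpha>v \<beta>v Kv :: "complex mat"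
  assumes Mu: "Mu \<in> carrier_mat p p" and Mv: "Mv \<in> carrier_mat p p"
    and au: "\<alpha>u \<in> carrier_mat p \<delta>" and av: "\<alpha>v \<in> carrier_mat p \<delta>"
    and bu: "\<beta>u \<in> carrier_mat p \<delta>" and bv: "\<beta>v \<in> carrier_mat p \<delta>"
    and Ku: "Ku \<in> carrier_mat \<delta> \<delta>" and Kv: "Kv \<in> carrier_mat \<delta> \<delta>"
    and U: "unitary_mat (p + \<delta>) (four_block_mat Mu \<alpha>u (mat_adjoint \<beta>u) Ku)"
    and V: "unitary_mat (p + \<delta>) (four_block_mat Mv \<alpha>v (mat_adjoint \<beta>v) Kv)"
    and pencil: "invertible_mat (ratvar \<cdot>\<^sub>m const_mat Kv - const_mat Ku)"
begin

abbreviation "R \<equiv> inv_mat (ratvar \<cdot>\<^sub>m const_mat Kv - const_mat Ku)"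
abbreviation "\<Phi> \<equiv> Phi p Mu \<alpha>u \<beta>u Ku Mv \<alpha>v \<beta>v Kv"
abbreviation "bu_adj \<equiv> const_mat (mat_adjoint \<beta>u)"
abbreviation "bv_adj \<equiv> const_mat (mat_adjoint \<beta>v)"

lemmas carriers = Mu[THEN const_mat_carrier(1)] Mv[THEN const_mat_carrier(1)]
  au[THEN const_mat_carrier(1)] av[THEN const_mat_carrier(1)]
  bu[THEN mat_adjoint_carrier(1), THEN const_mat_carrier(1)]
  bv[THEN mat_adjoint_carrier(1), THEN const_mat_carrier(1)]
  Ku[THEN const_mat_carrier(1)] Kv[THEN const_mat_carrier(1)]

lemma pencil_carrier: "ratvar \<cdot>\<^sub>m const_mat Kv - const_mat Ku \<in> carrier_mat \<delta> \<delta>"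
  using carriers(7) by (rule minus_carrier_mat)

lemmas R = inv_mat_of_invertible[OF pencil_carrier pencil]

lemma Phi_blocks:
  "\<Phi> = four_block_mat (const_mat Mu + const_mat \<alpha>u * R * bu_adj) (- (ratvar \<cdot>\<^sub>m (const_mat \<alpha>u * R * bv_adj)))
     (const_mat \<alpha>v * R * bu_adj) (const_mat Mv - ratvar \<cdot>\<^sub>m (const_mat \<alpha>v * R * bv_adj))"
proof -
  have M: "const_mat (diag_block_mat [Mu, Mv]) = diag_block_mat [const_mat Mu, const_mat Mv]"
    unfolding diag_block_mat_pair[OF Mu Mv] diag_block_mat_pair[OF carriers(1,2)]
    by (subst const_mat_four_block_mat[OF Mu zero_carrier_mat zero_carrier_mat Mv]) (simp add: const_mat_zero)
  have b: "const_mat (mat_adjoint (\<beta>u @\<^sub>r \<beta>v)) = bu_adj @\<^sub>c bv_adj"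
    unfolding mat_adjoint_append_rows[OF bu bv]
    by (rule const_mat_append_cols[OF mat_adjoint_carrier(1)[OF bu] mat_adjoint_carrier(1)[OF bv]])
  have J: "const_mat (J_mat p) = diag_block_mat [1\<^sub>m p, - 1\<^sub>m p]"
  proof -
    have "to_fract [:- 1 :: complex:] = - 1"
      using const_ratfun.hom_uminus[of 1] const_ratfun.hom_one by metis
    then show ?thesis
      unfolding J_mat_def by (intro eq_matI) (auto simp: Let_def const_mat_def)
  qed
  show ?thesis
    unfolding Phi_def Let_def M b J const_mat_append_rows[OF au av]
    by (rule Phi_expression_blocks[OF carriers(1-6) R(1)])
qed

lemma Phi_block_carriers:
  "const_mat Mu + const_mat \<alpha>u * R * bu_adj \<in> carrier_mat p p"
  "- (ratvar \<cdot>\<^sub>m (const_mat \<alpha>u * R * bv_adj)) \<in> carrier_mat p p"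
  "const_mat \<alpha>v * R * bu_adj \<in> carrier_mat p p"
  "const_mat Mv - ratvar \<cdot>\<^sub>m (const_mat \<alpha>v * R * bv_adj) \<in> carrier_mat p p"
proof -
  have "const_mat \<alpha>u * R * bu_adj \<in> carrier_mat p p" "const_mat \<alpha>u * R * bv_adj \<in> carrier_mat p p"
    "const_mat \<alpha>v * R * bu_adj \<in> carrier_mat p p" "const_mat \<alpha>v * R * bv_adj \<in> carrier_mat p p"
    by (rule mult_carrier_mat[OF mult_carrier_mat[OF _ R(1)]]; rule carriers)+
  then show "const_mat Mu + const_mat \<alpha>u * R * bu_adj \<in> carrier_mat p p"
    "- (ratvar \<cdot>\<^sub>m (const_mat \<alpha>u * R * bv_adj)) \<in> carrier_mat p p"
    "const_mat \<alpha>v * R * bu_adj \<in> carrier_mat p p"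
    "const_mat Mv - ratvar \<cdot>\<^sub>m (const_mat \<alpha>v * R * bv_adj) \<in> carrier_mat p p"
    by (auto intro!: minus_carrier_mat simp del: assoc_mult_mat)
qed

lemma Phi_carrier: "\<Phi> \<in> carrier_mat (2 * p) (2 * p)"
  unfolding Phi_blocks mult_2 by (rule four_block_carrier_mat[OF Phi_block_carriers(1,4)])

text \<open>
  Away from the finitely many poles of the resolvent \<open>R\<close>, evaluation turns \<open>R\<close> into the inverse of the
  evaluated pencil, so the lossless identity applies to the value of \<open>\<Phi>\<close>.
\<close>

lemma Phi_J_lossless: "J_lossless p \<Phi>"
proof (rule J_losslessI_off_finite[OF Phi_carrier finite_poles[of R]])
  fix z assume "z \<notin> {z. \<not> ratmat_analytic_at R z}"
  then have Rv: "ratmat_has_value R z (ratmat_eval R z)" by (intro ratmat_has_value_eval) simp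
  define Rz where "Rz = ratmat_eval R z"
  note Rv = Rv[folded Rz_def]
  have Rz: "Rz \<in> carrier_mat \<delta> \<delta>" using R(1) by (auto simp: Rz_def ratmat_eval_def)
  have pz: "ratmat_has_value (ratvar \<cdot>\<^sub>m const_mat Kv - const_mat Ku) z (z \<cdot>\<^sub>m Kv - Ku)"
    using Ku Kv
    by (intro ratmat_has_value_diff ratmat_has_value_smult_ratvar ratmat_has_value_const) auto
  have "ratmat_has_value (R * (ratvar \<cdot>\<^sub>m const_mat Kv - const_mat Ku)) z (Rz * (z \<cdot>\<^sub>m Kv - Ku))"
    by (rule ratmat_has_value_mult[OF Rv pz]) (use Rz Ku Kv in auto)
  then have "ratmat_has_value (const_mat (1\<^sub>m \<delta>)) z (Rz * (z \<cdot>\<^sub>m Kv - Ku))"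
    unfolding R(3) const_mat_one .
  then have inv: "Rz * (z \<cdot>\<^sub>m Kv - Ku) = 1\<^sub>m \<delta>"
    using ratmat_has_valueD ratmat_has_value_const by metis
  let ?b1 = "mat_adjoint \<beta>u" and ?b2 = "mat_adjoint \<beta>v"
  have bc: "?b1 \<in> carrier_mat \<delta> p" "?b2 \<in> carrier_mat \<delta> p" using bu bv by auto
  have tri: "ratmat_has_value (const_mat X * R * const_mat Y) z (X * Rz * Y)"
    if "X \<in> carrier_mat p \<delta>" "Y \<in> carrier_mat \<delta> p" for X Y
    by (intro ratmat_has_value_mult ratmat_has_value_const Rv) (use that Rz in auto)
  have tric: "X * Rz * Y \<in> carrier_mat p p" if "X \<in> carrier_mat p \<delta>" "Y \<in> carrier_mat \<delta> p" for X Y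
    using that Rz by (intro mult_carrier_mat[of _ p \<delta>]) auto
  note t = tri[OF au bc(1)] tri[OF au bc(2)] tri[OF av bc(1)] tri[OF av bc(2)]
  note tc = tric[OF au bc(1)] tric[OF au bc(2)] tric[OF av bc(1)] tric[OF av bc(2)]
  have "ratmat_has_value \<Phi> z (four_block_mat (Mu + \<alpha>u * Rz * ?b1) (- (z \<cdot>\<^sub>m (\<alpha>u * Rz * ?b2)))
      (\<alpha>v * Rz * ?b1) (Mv - z \<cdot>\<^sub>m (\<alpha>v * Rz * ?b2)))"
    unfolding Phi_blocks
    by (rule ratmat_has_value_four_block_mat[of _ _ _ _ _ _ _ _ _ p p p p])
      (use Mu Mv tc in \<open>auto intro!: minus_carrier_mat ratmat_has_value_add ratmat_has_value_diff ratmat_has_value_uminus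
        ratmat_has_value_smult_ratvar ratmat_has_value_const t simp del: assoc_mult_mat\<close>)
  then have e: "ratmat_eval \<Phi> z = four_block_mat (Mu + \<alpha>u * Rz * ?b1) (- (z \<cdot>\<^sub>m (\<alpha>u * Rz * ?b2)))
      (\<alpha>v * Rz * ?b1) (Mv - z \<cdot>\<^sub>m (\<alpha>v * Rz * ?b2))" by (rule ratmat_has_valueD)
  have "(\<alpha>u @\<^sub>r \<alpha>v) * Rz \<in> carrier_mat (2 * p) \<delta>"
    using au av Rz by (auto simp: mult_2 intro!: mult_carrier_mat[of _ _ \<delta>])
  moreover have "J_mat p - ratmat_eval \<Phi> z * J_mat p * mat_adjoint (ratmat_eval \<Phi> z) =
      complex_of_real ((cmod z)\<^sup>2 - 1) \<cdot>\<^sub>m (((\<alpha>u @\<^sub>r \<alpha>v) * Rz) * mat_adjoint ((\<alpha>u @\<^sub>r \<alpha>v) * Rz))"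
    unfolding e by (rule lossless_identity[OF Mu au bc(1) Ku Mv av bc(2) Kv Rz U V inv])
  ultimately show "\<exists>Q m. Q \<in> carrier_mat (2 * p) m \<and>
      J_mat p - ratmat_eval \<Phi> z * J_mat p * mat_adjoint (ratmat_eval \<Phi> z) =
      complex_of_real ((cmod z)\<^sup>2 - 1) \<cdot>\<^sub>m (Q * mat_adjoint Q)" by blast
qed

text \<open>
  The signal \<open>T\<close> is chosen such that the \<open>\<delta>\<close>-component of \<open>U (G, T)\<close> is \<open>z\<close> times that of \<open>V (1, T)\<close>: this
  is the equation \<open>(z K_v - K_u) T = \<beta>_u\<^sup>* G - z \<beta>_v\<^sup>*\<close>. With it, the other components \<open>Den\<close> and \<open>Num\<close> are
  denominator and numerator of the linear fractional transformation.
\<close>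

lemma lft_of_corresponds:
  assumes G: "G \<in> carrier_mat p p"
    and H: "corresponds p \<delta> (four_block_mat Mu \<alpha>u (mat_adjoint \<beta>u) Ku)
      (four_block_mat Mv \<alpha>v (mat_adjoint \<beta>v) Kv) G H"
  shows "invertible_mat (lft_den p \<Phi> G)" and "H = lft p \<Phi> G"
proof -
  let ?U = "four_block_mat Mu \<alpha>u (mat_adjoint \<beta>u) Ku" and ?V = "four_block_mat Mv \<alpha>v (mat_adjoint \<beta>v) Kv"
  let ?z = ratvar
  let ?c = const_mat
  define W where "W = bu_adj * G - ?z \<cdot>\<^sub>m bv_adj"
  define T where "T = R * W"
  define S where "S = bv_adj + ?c Kv * T"
  define Den where "Den = ?c Mv + ?c \<alpha>v * T"
  define Num where "Num = ?c Mu * G + ?c \<alpha>u * T"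
  have buG: "bu_adj * G \<in> carrier_mat \<delta> p" by (rule mult_carrier_mat[OF carriers(5) G])
  have zbv: "?z \<cdot>\<^sub>m bv_adj \<in> carrier_mat \<delta> p" using carriers(6) by simp
  have W: "W \<in> carrier_mat \<delta> p" unfolding W_def using zbv by (rule minus_carrier_mat)
  have T: "T \<in> carrier_mat \<delta> p" unfolding T_def by (rule mult_carrier_mat[OF R(1) W])
  have KvT: "?c Kv * T \<in> carrier_mat \<delta> p" and KuT: "?c Ku * T \<in> carrier_mat \<delta> p"
    and avT: "?c \<alpha>v * T \<in> carrier_mat p p" and auT: "?c \<alpha>u * T \<in> carrier_mat p p"
    by (rule mult_carrier_mat[OF _ T], rule carriers)+
  have S: "S \<in> carrier_mat \<delta> p" and Den: "Den \<in> carrier_mat p p" and Num: "Num \<in> carrier_mat p p"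
    unfolding S_def Den_def Num_def using KvT avT auT by auto
  have bc: "mat_adjoint \<beta>u \<in> carrier_mat \<delta> p" "mat_adjoint \<beta>v \<in> carrier_mat \<delta> p" using bu bv by auto
  \<comment> \<open>Multiplying \<open>T\<close> by the pencil: the defining equation of the internal signal.\<close>
  have "(?z \<cdot>\<^sub>m ?c Kv - ?c Ku) * T = (?z \<cdot>\<^sub>m ?c Kv - ?c Ku) * R * W"
    unfolding T_def by (rule assoc_mult_mat[symmetric, OF pencil_carrier R(1) W])
  also have "\<dots> = W" unfolding R(2) by (rule left_mult_one_mat[OF W])
  also have "(?z \<cdot>\<^sub>m ?c Kv - ?c Ku) * T = ?z \<cdot>\<^sub>m ?c Kv * T - ?c Ku * T"
    by (rule minus_mult_distrib_mat[OF _ carriers(7) T]) (use carriers(8) in simp)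
  also have "?z \<cdot>\<^sub>m ?c Kv * T = ?z \<cdot>\<^sub>m (?c Kv * T)" by (rule mult_smult_assoc_mat[OF carriers(8) T])
  finally have signal: "?z \<cdot>\<^sub>m (?c Kv * T) - ?c Ku * T = bu_adj * G - ?z \<cdot>\<^sub>m bv_adj" unfolding W_def .
  have zS: "bu_adj * G + ?c Ku * T = ?z \<cdot>\<^sub>m S"
  proof (rule eq_matI)
    fix i j assume "i < dim_row (?z \<cdot>\<^sub>m S)" "j < dim_col (?z \<cdot>\<^sub>m S)"
    then have ij: "i < \<delta>" "j < p" using S by auto
    note d = buG KuT KvT zbv carriers(6)
    note d' = d[THEN carrier_matD(1)] d[THEN carrier_matD(2)]
    have "?z * (?c Kv * T) $$ (i, j) - (?c Ku * T) $$ (i, j) = (bu_adj * G) $$ (i, j) - ?z * bv_adj $$ (i, j)"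
      using arg_cong[OF signal, of "\<lambda>M. M $$ (i, j)"] ij d' by (simp del: index_mult_mat)
    then show "(bu_adj * G + ?c Ku * T) $$ (i, j) = (?z \<cdot>\<^sub>m S) $$ (i, j)"
      unfolding S_def using ij d' by (simp del: index_mult_mat add: algebra_simps)
  qed (use S KuT in auto)
  have VT: "?c ?V * (1\<^sub>m p @\<^sub>r T) = Den @\<^sub>r S"
    unfolding const_mat_four_block_mat[OF Mv av bc(2) Kv]
      four_block_mat_mult_append_rows[OF carriers(2,4,6,8) one_carrier_mat T] Den_def S_def
    by (simp add: right_mult_one_mat[OF carriers(2)] right_mult_one_mat[OF carriers(6)])
  have UT: "?c ?U * (G @\<^sub>r T) = Num @\<^sub>r (?z \<cdot>\<^sub>m S)"
    unfolding const_mat_four_block_mat[OF Mu au bc(1) Ku]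
      four_block_mat_mult_append_rows[OF carriers(1,3,5,7) G T] Num_def zS ..
  have lft_blocks: "lft_den p \<Phi> G = Den" "lft_num p \<Phi> G = Num"
  proof -
    have sb: "split_block \<Phi> p p =
      (?c Mu + ?c \<alpha>u * R * bu_adj, - (?z \<cdot>\<^sub>m (?c \<alpha>u * R * bv_adj)),
       ?c \<alpha>v * R * bu_adj, ?c Mv - ?z \<cdot>\<^sub>m (?c \<alpha>v * R * bv_adj))"
      unfolding Phi_blocks by (rule split_block_four_block_mat[OF Phi_block_carriers])
    have aT: "a * T = a * R * bu_adj * G - ?z \<cdot>\<^sub>m (a * R * bv_adj)" and aRc: "a * R * bu_adj * G \<in> carrier_mat p p"
       "a * R * bv_adj \<in> carrier_mat p p" "a * R * bu_adj \<in> carrier_mat p p"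
      if a: "a \<in> carrier_mat p \<delta>" for a
    proof -
      have aR: "a * R \<in> carrier_mat p \<delta>" by (rule mult_carrier_mat[OF a R(1)])
      show "a * R * bv_adj \<in> carrier_mat p p" by (rule mult_carrier_mat[OF aR carriers(6)])
      show *: "a * R * bu_adj \<in> carrier_mat p p" by (rule mult_carrier_mat[OF aR carriers(5)])
      show "a * R * bu_adj * G \<in> carrier_mat p p" by (rule mult_carrier_mat[OF * G])
      have "a * T = a * R * W"
        unfolding T_def by (rule assoc_mult_mat[symmetric, OF a R(1) W])
      also have "\<dots> = a * R * (bu_adj * G) - a * R * (?z \<cdot>\<^sub>m bv_adj)"
        unfolding W_def by (rule mult_minus_distrib_mat[OF aR buG zbv])
      also have "a * R * (bu_adj * G) = a * R * bu_adj * G"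
        by (rule assoc_mult_mat[symmetric, OF aR carriers(5) G])
      also have "a * R * (?z \<cdot>\<^sub>m bv_adj) = ?z \<cdot>\<^sub>m (a * R * bv_adj)"
        by (rule mult_smult_distrib[OF aR carriers(6)])
      finally show "a * T = a * R * bu_adj * G - ?z \<cdot>\<^sub>m (a * R * bv_adj)" .
    qed
    note cv = aRc[OF carriers(4)] and cu = aRc[OF carriers(3)]
    note cvd = cv[THEN carrier_matD(1)] cv[THEN carrier_matD(2)] carriers(2)[THEN carrier_matD(1)] carriers(2)[THEN carrier_matD(2)]
    show "lft_den p \<Phi> G = Den"
      unfolding lft_den_def sb Den_def aT[OF carriers(4)] prod.case
      by (rule eq_matI) (use cvd in \<open>auto simp del: index_mult_mat assoc_mult_mat\<close>)
    have MuG: "?c Mu * G \<in> carrier_mat p p" by (rule mult_carrier_mat[OF carriers(1) G])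
    note cud = cu[THEN carrier_matD(1)] cu[THEN carrier_matD(2)] MuG[THEN carrier_matD(1)] MuG[THEN carrier_matD(2)]
    show "lft_num p \<Phi> G = Num"
      unfolding lft_num_def sb Num_def aT[OF carriers(3)] prod.case
        add_mult_distrib_mat[OF carriers(1) cu(3) G]
      by (rule eq_matI) (use cud in \<open>auto simp del: index_mult_mat assoc_mult_mat\<close>)
  qed
  obtain k A B C D A' B' C' D' where min: "is_minimal_realization p k A B C D G"
    and upd: "realization_update p \<delta> ?U ?V k A B C D A' B' C' D'"
    and Heq: "H = transfer_function (\<delta> + k) A' B' C' D'"
    using H unfolding corresponds_def by blast
  have r: "A \<in> carrier_mat k k" "B \<in> carrier_mat k p" "C \<in> carrier_mat p k" "D \<in> carrier_mat p p"
    and Geq: "G = transfer_function k A B C D"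
    using min unfolding is_minimal_realization_def is_realization_def by auto
  have Uc: "?U \<in> carrier_mat (p + \<delta>) (p + \<delta>)" using U unfolding unitary_mat_def by blast
  note tfu = transfer_function_realization_update[OF r Uc V upd T S Den Num VT UT[unfolded Geq]]
  obtain L where L: "L \<in> carrier_mat p p" "L * Den = 1\<^sub>m p" using tfu(2) by blast
  note inv = inv_mat_of_left_inverse[OF Den L]
  show "invertible_mat (lft_den p \<Phi> G)" unfolding lft_blocks by (rule inv(4))
  have Hc: "H \<in> carrier_mat p p"
    unfolding Heq using upd by (intro transfer_function_carrier) (auto simp: realization_update_def)
  have "H = H * (Den * inv_mat Den)" unfolding inv(2) using Hc by simp
  also have "\<dots> = H * Den * inv_mat Den" by (rule assoc_mult_mat[symmetric, OF Hc Den inv(1)])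
  also have "\<dots> = Num * inv_mat Den" unfolding Heq tfu(1) ..
  finally show "H = lft p \<Phi> G" unfolding lft_def lft_blocks .
qed

end

theorem proposition1:
  fixes p \<delta> :: nat
    and Mu \<alpha>u \<beta>u Ku Mv \<alpha>v \<beta>v Kv U V :: "complex mat"
  assumes "Mu \<in> carrier_mat p p" and "Mv \<in> carrier_mat p p"
    and "\<alpha>u \<in> carrier_mat p \<delta>" and "\<alpha>v \<in> carrier_mat p \<delta>"
    and "\<beta>u \<in> carrier_mat p \<delta>" and "\<beta>v \<in> carrier_mat p \<delta>"
    and "Ku \<in> carrier_mat \<delta> \<delta>" and "Kv \<in> carrier_mat \<delta> \<delta>"
    and "U = four_block_mat Mu \<alpha>u (mat_adjoint \<beta>u) Ku"
    and "V = four_block_mat Mv \<alpha>v (mat_adjoint \<beta>v) Kv"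
    and "unitary_mat (p + \<delta>) U" and "unitary_mat (p + \<delta>) V"
    and "invertible_mat (ratvar \<cdot>\<^sub>m const_mat Kv - const_mat Ku)"
  shows "(\<forall>G \<in> carrier_mat p p. ratmat_proper G \<longrightarrow> (\<exists>!H. corresponds p \<delta> U V G H)) \<and>
    (\<forall>G \<in> carrier_mat p p. ratmat_proper G \<longrightarrow>
       invertible_mat (lft_den p (Phi p Mu \<alpha>u \<beta>u Ku Mv \<alpha>v \<beta>v Kv) G) \<and>
       (\<forall>H. corresponds p \<delta> U V G H \<longrightarrow>
          H = lft p (Phi p Mu \<alpha>u \<beta>u Ku Mv \<alpha>v \<beta>v Kv) G)) \<and>
    J_lossless p (Phi p Mu \<alpha>u \<beta>u Ku Mv \<alpha>v \<beta>v Kv)"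
proof -
  interpret unitary_pair p \<delta> Mu \<alpha>u \<beta>u Ku Mv \<alpha>v \<beta>v Kv
    using assms by unfold_locales auto
  have ex: "\<exists>H. corresponds p \<delta> U V G H" if "G \<in> carrier_mat p p" "ratmat_proper G" for G
    using that assms(11,12) by (intro corresponds_exists) (auto simp: unitary_mat_def)
  have lft: "invertible_mat (lft_den p \<Phi> G)" "H = lft p \<Phi> G"
    if "G \<in> carrier_mat p p" "corresponds p \<delta> U V G H" for G H
    using lft_of_corresponds[OF that(1) that(2)[unfolded assms(9,10)]] .
  have unique: "\<exists>!H. corresponds p \<delta> U V G H"
    if "G \<in> carrier_mat p p" "ratmat_proper G" for G
    using ex[OF that] lft(2)[OF that(1)] by metis
  have inv: "invertible_mat (lft_den p \<Phi> G)"
    if "G \<in> carrier_mat p p" "ratmat_proper G" for G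
    using ex[OF that] lft(1)[OF that(1)] by (elim exE)
  show ?thesis
    by (intro conjI ballI impI allI unique inv lft(2) Phi_J_lossless)
qed

end
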